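(* Let $\Sigma(A,B,B^* )$, with $Bu=bu$, be a minimal collocated skew-adjoint system on a Hilbert space $\mathcal Z$ with $b\in D((-A)^{1/2})$. Denote its invariant zeros by $\{\mu_n\}$. Then for any $\varepsilon>0$ there is $N\in\mathbb N$ such that for every $n\ge N$, $|\mu_n-\lambda|<\varepsilon$ for some eigenvalue $\lambda$ of $A$.
   Context: $\mathcal Z$ is a complex Hilbert space. A system $\Sigma(A,B,C)$ consists of the generator $A:D(A)\subset\mathcal Z\to\mathcal Z$ of a $C_0$-semigroup on $\mathcal Z$ and bounded operators $B:\mathbb C\to\mathcal Z$, $Bu=bu$, and $C:\mathcal Z\to\mathbb C$, $Cx=\langle x,c\rangle$, with $b,c\in\mathcal Z$ and $B,C\neq0$. Standing assumption: $\sigma(A)$ is non-empty and consists only of isolated eigenvalues with finite algebraic multiplicity. The system is collocated skew-adjoint if $A^*=-A$ and $C=B^*$ (i.e. $c=b$). A skew-adjoint $A$ generates a bounded (unitary) $C_0$-group, so the fractional power $(-A)^{1/2}$ is well-defined (as for any generator of a bounded $C_0$-semigroup). An invariant zero is a $\lambda\in\mathbb C$ for which there are a non-zero $x\in D(A)$ and a scalar $u$ with $(\lambda I-A)x-Bu=0$ and $Cx=0$. The system is minimal if no invariant zero belongs to $\sigma(A)$. For a minimal system the set of invariant zeros is countable with no finite accumulation point, and $\{\mu_n\}$ is an enumeration of it. *)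

theory Defs
  imports "HOL-Analysis.Analysis"
begin

section \<open>Complex Hilbert spaces\<close>

text \<open>
  The complex inner product is linear in its first argument. The real structure of
  \<^class>\<open>real_inner\<close> is the underlying one: its inner product is the real part of the complex one,
  so positive definiteness and the norm are inherited from \<^class>\<open>real_inner\<close>.
\<close>

class complex_hilbert_space = real_inner + complete_space +
  fixes scaleC :: "complex \<Rightarrow> 'a \<Rightarrow> 'a" (infixr "*\<^sub>C" 75)
    and cinner :: "'a \<Rightarrow> 'a \<Rightarrow> complex"
  assumes scaleC_add_right: "a *\<^sub>C (x + y) = a *\<^sub>C x + a *\<^sub>C y"
    and scaleC_add_left: "(a + b) *\<^sub>C x = a *\<^sub>C x + b *\<^sub>C x"
    and scaleC_scaleC: "a *\<^sub>C (b *\<^sub>C x) = (a * b) *\<^sub>C x"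
    and scaleR_scaleC: "r *\<^sub>R x = complex_of_real r *\<^sub>C x"
    and cinner_commute: "cinner x y = cnj (cinner y x)"
    and cinner_add_left: "cinner (x + y) z = cinner x z + cinner y z"
    and cinner_scaleC_left: "cinner (a *\<^sub>C x) y = a * cinner x y"
    and inner_eq_Re_cinner: "inner x y = Re (cinner x y)"
begin

subclass banach ..

end

global_interpretation complex_vector:
  vector_space "scaleC :: complex \<Rightarrow> 'a \<Rightarrow> 'a::complex_hilbert_space"
proof
  show "1 *\<^sub>C x = x" for x :: 'a
    using scaleR_scaleC[of 1 x] by simp
qed (simp_all add: scaleC_add_right scaleC_add_left scaleC_scaleC)

instantiation complex :: complex_hilbert_space
begin

definition scaleC_complex :: "complex \<Rightarrow> complex \<Rightarrow> complex"
  where "scaleC_complex a z = a * z"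

definition cinner_complex :: "complex \<Rightarrow> complex \<Rightarrow> complex"
  where "cinner_complex z w = z * cnj w"

instance
  by standard
    (simp_all add: scaleC_complex_def cinner_complex_def inner_complex_def
      scaleR_conv_of_real algebra_simps)

end

section \<open>Operators\<close>

text \<open>
  An operator with domain \<open>D\<close> is a pair of a set \<open>D\<close> and a total function; the values of
  the function outside \<open>D\<close> are irrelevant. Operator identities that include equality of the
  domains are stated as equality of graphs.
\<close>

definition bounded_clinear ::
    "('a::complex_hilbert_space \<Rightarrow> 'b::complex_hilbert_space) \<Rightarrow> bool"
  where "bounded_clinear F \<longleftrightarrow> bounded_linear F \<and> (\<forall>a x. F (a *\<^sub>C x) = a *\<^sub>C F x)"

definition op_graph :: "'a set \<Rightarrow> ('a \<Rightarrow> 'b) \<Rightarrow> ('a \<times> 'b) set"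
  where "op_graph D A = {(x, A x) |x. x \<in> D}"

text \<open>
  The graph of the Hilbert space adjoint; it is the graph of a function exactly when \<open>D\<close> is dense.
\<close>

definition adjoint_graph ::
    "'a::complex_hilbert_space set \<Rightarrow> ('a \<Rightarrow> 'b::complex_hilbert_space) \<Rightarrow> ('b \<times> 'a) set"
  where "adjoint_graph D A = {(y, z). \<forall>x\<in>D. cinner (A x) y = cinner x z}"

section \<open>Spectrum\<close>

definition resolvent ::
    "'a::complex_hilbert_space set \<Rightarrow> ('a \<Rightarrow> 'a) \<Rightarrow> complex \<Rightarrow> 'a \<Rightarrow> 'a"
  where "resolvent D A l = inv_into D (\<lambda>x. l *\<^sub>C x - A x)"

definition resolvent_set :: "'a::complex_hilbert_space set \<Rightarrow> ('a \<Rightarrow> 'a) \<Rightarrow> complex set"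
  where "resolvent_set D A =
    {l. bij_betw (\<lambda>x. l *\<^sub>C x - A x) D UNIV \<and> bounded_clinear (resolvent D A l)}"

definition spectrum :: "'a::complex_hilbert_space set \<Rightarrow> ('a \<Rightarrow> 'a) \<Rightarrow> complex set"
  where "spectrum D A = - resolvent_set D A"

definition eigenvalue :: "'a::complex_hilbert_space set \<Rightarrow> ('a \<Rightarrow> 'a) \<Rightarrow> complex \<Rightarrow> bool"
  where "eigenvalue D A l \<longleftrightarrow> (\<exists>x\<in>D. x \<noteq> 0 \<and> A x = l *\<^sub>C x)"

text \<open>
  The Riesz projection $\frac{1}{2\pi i}\oint_{|z-l|=r} (zI-A)^{-1}x\,dz$, parametrised by
  $z = l + re^{it}$.
\<close>

definition riesz_projection ::
    "'a::complex_hilbert_space set \<Rightarrow> ('a \<Rightarrow> 'a) \<Rightarrow> complex \<Rightarrow> real \<Rightarrow> 'a \<Rightarrow> 'a"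
  where "riesz_projection D A l r x =
    (r / (2 * pi)) *\<^sub>R integral {0..2 * pi} (\<lambda>t. cis t *\<^sub>C resolvent D A (l + r * cis t) x)"

text \<open>
  The algebraic multiplicity of an isolated point of the spectrum is the dimension of the range of
  its Riesz projection, for any radius that separates the point from the rest of the spectrum.
\<close>

definition finite_algebraic_multiplicity ::
    "'a::complex_hilbert_space set \<Rightarrow> ('a \<Rightarrow> 'a) \<Rightarrow> complex \<Rightarrow> bool"
  where "finite_algebraic_multiplicity D A l \<longleftrightarrow>
    (\<exists>r>0. cball l r \<inter> spectrum D A = {l} \<and>
      (\<exists>S. finite S \<and> range (riesz_projection D A l r) \<subseteq> complex_vector.span S))"

section \<open>Semigroups\<close>

definition c0_semigroup :: "(real \<Rightarrow> 'a::complex_hilbert_space \<Rightarrow> 'a) \<Rightarrow> bool"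
  where "c0_semigroup T \<longleftrightarrow>
    (\<forall>t\<ge>0. bounded_clinear (T t)) \<and>
    (\<forall>x. T 0 x = x) \<and>
    (\<forall>s\<ge>0. \<forall>t\<ge>0. \<forall>x. T (s + t) x = T s (T t x)) \<and>
    (\<forall>x. ((\<lambda>t. T t x) \<longlongrightarrow> x) (at_right 0))"

definition generates ::
    "'a::complex_hilbert_space set \<Rightarrow> ('a \<Rightarrow> 'a) \<Rightarrow> (real \<Rightarrow> 'a \<Rightarrow> 'a) \<Rightarrow> bool"
  where "generates D A T \<longleftrightarrow>
    op_graph D A = {(x, y). ((\<lambda>t. (1 / t) *\<^sub>R (T t x - x)) \<longlongrightarrow> y) (at_right 0)}"

section \<open>Fractional powers\<close>

text \<open>
  Balakrishnan's definition of \<open>L\<close> to the power \<open>\<alpha>\<close>, $0 < \alpha < 1$, where \<open>-L\<close> generates a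
  bounded semigroup: the closure of the operator
  $x \mapsto \frac{\sin \pi\alpha}{\pi}\int_0^\infty s^{\alpha-1}(s+L)^{-1}Lx\,ds$ on \<open>D\<close>.
\<close>

definition balakrishnan_graph ::
    "real \<Rightarrow> 'a::complex_hilbert_space set \<Rightarrow> ('a \<Rightarrow> 'a) \<Rightarrow> ('a \<times> 'a) set"
  where "balakrishnan_graph \<alpha> D L = {(x, y). x \<in> D \<and>
    ((\<lambda>s. (sin (pi * \<alpha>) / pi * s powr (\<alpha> - 1)) *\<^sub>R
        resolvent D (\<lambda>x. - L x) (complex_of_real s) (L x)) has_integral y) {0<..}}"

definition frac_power_graph ::
    "real \<Rightarrow> 'a::complex_hilbert_space set \<Rightarrow> ('a \<Rightarrow> 'a) \<Rightarrow> ('a \<times> 'a) set"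
  where "frac_power_graph \<alpha> D L = closure (balakrishnan_graph \<alpha> D L)"

definition frac_power_domain ::
    "real \<Rightarrow> 'a::complex_hilbert_space set \<Rightarrow> ('a \<Rightarrow> 'a) \<Rightarrow> 'a set"
  where "frac_power_domain \<alpha> D L = fst ` frac_power_graph \<alpha> D L"

section \<open>Systems\<close>

text \<open>The last two conditions are the standing assumption on the spectrum.\<close>

definition siso_system ::
    "'z::complex_hilbert_space set \<Rightarrow> ('z \<Rightarrow> 'z) \<Rightarrow> (complex \<Rightarrow> 'z) \<Rightarrow> ('z \<Rightarrow> complex) \<Rightarrow> bool"
  where "siso_system D A B C \<longleftrightarrow>
    (\<exists>T. c0_semigroup T \<and> generates D A T) \<and>
    bounded_clinear B \<and> B \<noteq> (\<lambda>u. 0) \<and>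
    bounded_clinear C \<and> C \<noteq> (\<lambda>x. 0) \<and>
    spectrum D A \<noteq> {} \<and>
    (\<forall>l\<in>spectrum D A. l isolated_in spectrum D A \<and> eigenvalue D A l \<and>
      finite_algebraic_multiplicity D A l)"

definition collocated_skew_adjoint ::
    "'z::complex_hilbert_space set \<Rightarrow> ('z \<Rightarrow> 'z) \<Rightarrow> (complex \<Rightarrow> 'z) \<Rightarrow> ('z \<Rightarrow> complex) \<Rightarrow> bool"
  where "collocated_skew_adjoint D A B C \<longleftrightarrow>
    adjoint_graph D A = op_graph D (\<lambda>x. - A x) \<and>
    adjoint_graph UNIV B = op_graph UNIV C"

definition invariant_zeros ::
    "'z::complex_hilbert_space set \<Rightarrow> ('z \<Rightarrow> 'z) \<Rightarrow> (complex \<Rightarrow> 'z) \<Rightarrow> ('z \<Rightarrow> complex) \<Rightarrow> complex set"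
  where "invariant_zeros D A B C =
    {l. \<exists>x\<in>D. \<exists>u. x \<noteq> 0 \<and> (l *\<^sub>C x - A x) - B u = 0 \<and> C x = 0}"

definition minimal_system ::
    "'z::complex_hilbert_space set \<Rightarrow> ('z \<Rightarrow> 'z) \<Rightarrow> (complex \<Rightarrow> 'z) \<Rightarrow> ('z \<Rightarrow> complex) \<Rightarrow> bool"
  where "minimal_system D A B C \<longleftrightarrow> invariant_zeros D A B C \<inter> spectrum D A = {}"

end

theory Submission
  imports Defs "HOL-Complex_Analysis.Complex_Analysis"
begin

text \<open>
  The eigenvectors of a skew-adjoint \<open>A\<close> with isolated spectrum are complete, and minimality makes the
  eigenvalues \<open>l\<close> simple with weights $w_l = |\langle b, e_l\rangle|^2 > 0$. The invariant zeros are then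
  the zeros of $\sum_l \frac{w_l}{z - l}$, all of them on the imaginary axis. Let \<open>\<epsilon> > 0\<close> and consider
  the zeros at distance at least \<open>\<epsilon>\<close> from the spectrum. They are bounded because
  $b \in D((-A)^{1/2})$ means $\sum_l |l| w_l < \infty$, and any two of them are at least \<open>\<epsilon>\<close> apart
  because the sum is strictly monotone between consecutive poles. Hence they are finitely many.
\<close>

text \<open>Completeness is the analytic core, and it is drawn from scalar complex analysis instead
  of a spectral measure: for \<open>x\<close> orthogonal to all eigenvectors,
  \<open>cinner (R z x) x\<close> is extended to an entire function, which is shown to vanish at
  \<open>1\<close>. The difficulty is its behaviour at a point \<open>l\<close> of the spectrum.
  Skewness directly bounds the resolvent by \<open>1 / \<bar>Re z\<bar>\<close>, which degenerates
  when \<open>z\<close> approaches \<open>l\<close> along the imaginary axis. A variational argument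
  replaces this by the inverse distance to \<open>l\<close>, which leaves at most a simple pole; its
  residue is then the pairing of \<open>x\<close> with a vector in the kernel of
  \<open>l - A\<close>, hence zero. Sums over the spectrum are unordered, so no numbering of the
  eigenvalues is ever fixed.\<close>

section \<open>Complex inner products\<close>

lemma scaleC_minus1 [simp]: "(-1) *\<^sub>C (x::'a::complex_hilbert_space) = - x"
  by (metis complex_vector.scale_minus_left complex_vector.scale_one)

lemma cinner_add_right: "cinner x (y + z) = cinner x y + cinner (x::'a::complex_hilbert_space) z"
  by (metis cinner_add_left cinner_commute complex_cnj_add)

lemma cinner_scaleC_right:
  "cinner x (a *\<^sub>C y) = cnj a * cinner (x::'a::complex_hilbert_space) y"
  by (metis cinner_commute cinner_scaleC_left complex_cnj_mult)

lemma cinner_0_left [simp]: "cinner 0 (y::'a::complex_hilbert_space) = 0"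
  by (metis cinner_scaleC_left mult_zero_left complex_vector.scale_zero_left)

lemma cinner_0_right [simp]: "cinner (y::'a::complex_hilbert_space) 0 = 0"
  by (metis cinner_commute cinner_0_left complex_cnj_zero)

lemma cinner_minus_left: "cinner (- x) y = - cinner (x::'a::complex_hilbert_space) y"
  by (metis cinner_scaleC_left mult_minus1 scaleC_minus1)

lemma cinner_minus_right: "cinner x (- y) = - cinner (x::'a::complex_hilbert_space) y"
  by (metis cinner_commute cinner_minus_left complex_cnj_minus)

lemma cinner_diff_left: "cinner (x - y) z = cinner x z - cinner (y::'a::complex_hilbert_space) z"
  using cinner_add_left[of x "- y" z] by (simp add: cinner_minus_left)

lemma cinner_diff_right: "cinner z (x - y) = cinner z x - cinner (z::'a::complex_hilbert_space) y"
  using cinner_add_right[of z x "- y"] by (simp add: cinner_minus_right)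

lemma cinner_scaleR_left: "cinner (r *\<^sub>R x) y = of_real r * cinner (x::'a::complex_hilbert_space) y"
  by (simp add: scaleR_scaleC cinner_scaleC_left)

lemma cinner_sum_left: "cinner (sum f F) y = (\<Sum>i\<in>F. cinner (f i) (y::'a::complex_hilbert_space))"
  by (induction F rule: infinite_finite_induct) (auto simp: cinner_add_left)

lemma cinner_self: "cinner x x = of_real ((norm (x::'a::complex_hilbert_space))\<^sup>2)"
proof (rule complex_eqI)
  show "Re (cinner x x) = Re (of_real ((norm x)\<^sup>2))"
    by (simp flip: inner_eq_Re_cinner add: dot_square_norm)
  have "Im (cinner x x) = - Im (cinner x x)"
    by (metis cinner_commute cnj.simps(2))
  then show "Im (cinner x x) = Im (of_real ((norm x)\<^sup>2))"
    by simp
qed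

text \<open>For a unit vector \<open>y\<close> this pairs the component of \<open>x\<close> along
  \<open>y\<close> with \<open>x\<close>. It serves both Bessel's inequality and the weights
  \<open>w\<close>.\<close>

lemma cinner_coeff:
  "cinner (cinner x y *\<^sub>C y) x = of_real ((cmod (cinner x (y::'a::complex_hilbert_space)))\<^sup>2)"
  using complex_norm_square[of "cinner x y"]
  by (simp add: cinner_scaleC_left cinner_commute[of y x])

lemma norm_scaleC [simp]: "norm (a *\<^sub>C (x::'a::complex_hilbert_space)) = cmod a * norm x"
proof -
  have "complex_of_real ((norm (a *\<^sub>C x))\<^sup>2) = of_real ((cmod a * norm x)\<^sup>2)"
    unfolding cinner_self[symmetric] cinner_scaleC_left cinner_scaleC_right
    using complex_norm_square[of a]
    by (simp add: cinner_self power_mult_distrib flip: mult.assoc)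
  then show ?thesis
    by (metis mult_nonneg_nonneg norm_ge_zero of_real_eq_iff power2_eq_iff_nonneg)
qed

text \<open>Multiplying \<open>x\<close> by the conjugate phase of \<open>cinner x y\<close> makes
  the product a nonnegative real, which reduces the claim to the real inequality of
  \<open>real_inner\<close>.\<close>

lemma cinner_Cauchy_Schwarz: "cmod (cinner x y) \<le> norm x * norm (y::'a::complex_hilbert_space)"
proof (cases "cinner x y = 0")
  case False
  define a where "a = cnj (sgn (cinner x y))"
  have a: "cmod a = 1"
    using False by (simp add: a_def norm_sgn)
  have "cmod (cinner x y) = Re (a * cinner x y)"
    using False cmod_power2[of "cinner x y"]
    by (simp add: a_def sgn_div_norm scaleR_conv_of_real mult.commute power2_eq_square field_simps)
  also have "\<dots> = inner (a *\<^sub>C x) y"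
    by (simp add: inner_eq_Re_cinner cinner_scaleC_left)
  also have "\<dots> \<le> norm (a *\<^sub>C x) * norm y"
    by (rule norm_cauchy_schwarz)
  finally show ?thesis
    using a by simp
qed simp

lemma bounded_linear_cinner_left: "bounded_linear (\<lambda>x::'a::complex_hilbert_space. cinner x y)"
proof (rule bounded_linear_intro[where K="norm y"])
  show "cinner (r *\<^sub>R x) y = r *\<^sub>R cinner x y" for r and x :: 'a
    by (simp add: cinner_scaleR_left scaleR_conv_of_real)
qed (auto simp: cinner_add_left cinner_Cauchy_Schwarz)

lemma bounded_linear_cinner_right: "bounded_linear (\<lambda>y::'a::complex_hilbert_space. cinner x y)"
proof (rule bounded_linear_intro[where K="norm x"])
  show "cinner x (r *\<^sub>R y) = r *\<^sub>R cinner x y" for r and y :: 'a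
    by (simp add: scaleR_scaleC[of r y] cinner_scaleC_right scaleR_conv_of_real)
qed (use cinner_Cauchy_Schwarz[of x] in \<open>auto simp: cinner_add_right mult.commute\<close>)

lemmas tendsto_cinner_left = bounded_linear.tendsto[OF bounded_linear_cinner_left]
  and tendsto_cinner_right = bounded_linear.tendsto[OF bounded_linear_cinner_right]

lemma bounded_linear_scaleC_right: "bounded_linear (\<lambda>x::'a::complex_hilbert_space. a *\<^sub>C x)"
proof (rule bounded_linear_intro[where K="cmod a"])
  show "a *\<^sub>C (r *\<^sub>R x) = r *\<^sub>R (a *\<^sub>C x)" for r and x :: 'a
    by (simp add: scaleR_scaleC scaleC_scaleC mult.commute)
qed (auto simp: scaleC_add_right)

lemmas scaleC_minus_left = complex_vector.scale_minus_left
  and scaleC_diff_right = complex_vector.scale_right_diff_distrib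
  and scaleC_diff_left = complex_vector.scale_left_diff_distrib

lemma has_sum_diff:
  fixes f g :: "'a \<Rightarrow> 'b::topological_ab_group_add"
  assumes "(f has_sum a) X" "(g has_sum b) X"
  shows "((\<lambda>x. f x - g x) has_sum (a - b)) X"
  using has_sum_add[OF assms(1), of "\<lambda>x. - g x" "- b"] assms(2) by (simp add: has_sum_uminus)

section \<open>Skew-adjoint operators with discrete spectrum\<close>

locale skew_adjoint_discrete =
  fixes D :: "'z::complex_hilbert_space set" and A :: "'z \<Rightarrow> 'z"
  assumes adjoint_eq: "adjoint_graph D A = op_graph D (\<lambda>x. - A x)"
    and isolated: "l \<in> spectrum D A \<Longrightarrow> l isolated_in spectrum D A"
    and spectrum_eigenvalue: "l \<in> spectrum D A \<Longrightarrow> eigenvalue D A l"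
begin

abbreviation "S \<equiv> spectrum D A"
abbreviation "R \<equiv> resolvent D A"

text \<open>Membership in \<open>D\<close> is obtained by duality: a vector \<open>z\<close> that
  represents the functional \<open>cinner (A x) y\<close> on \<open>D\<close> puts \<open>y\<close>
  into \<open>D\<close> and evaluates \<open>A y\<close>. Linearity of \<open>D\<close> and
  \<open>A\<close> is derived this way.\<close>

lemma adjoint_iff: "(\<forall>x\<in>D. cinner (A x) y = cinner x z) \<longleftrightarrow> y \<in> D \<and> z = - A y"
proof -
  have "(y, z) \<in> adjoint_graph D A \<longleftrightarrow> (y, z) \<in> op_graph D (\<lambda>x. - A x)"
    by (simp add: adjoint_eq)
  then show ?thesis
    by (auto simp: adjoint_graph_def op_graph_def)
qed

lemma skew: "x \<in> D \<Longrightarrow> y \<in> D \<Longrightarrow> cinner (A x) y = - cinner x (A y)"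
  using adjoint_iff[of y "- A y"] by (simp add: cinner_minus_right)

lemma add_closed: "x \<in> D \<Longrightarrow> y \<in> D \<Longrightarrow> x + y \<in> D"
  and A_add: "x \<in> D \<Longrightarrow> y \<in> D \<Longrightarrow> A (x + y) = A x + A y"
  using adjoint_iff[of "x + y" "- A x - A y"]
  by (auto simp: cinner_add_right cinner_diff_right cinner_minus_right skew)
    (metis add.commute minus_add_distrib minus_minus uminus_add_conv_diff)

lemma scaleC_closed: "x \<in> D \<Longrightarrow> a *\<^sub>C x \<in> D"
  and A_scaleC: "x \<in> D \<Longrightarrow> A (a *\<^sub>C x) = a *\<^sub>C A x"
  using adjoint_iff[of "a *\<^sub>C x" "- (a *\<^sub>C A x)"]
  by (auto simp: cinner_scaleC_right cinner_minus_right skew)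

lemma A_0: "A 0 = 0"
  using adjoint_iff[of 0 0] by auto

lemma diff_closed: "x \<in> D \<Longrightarrow> y \<in> D \<Longrightarrow> x - y \<in> D"
  using add_closed[of x "(-1) *\<^sub>C y"] scaleC_closed[of y "-1"] by simp

lemma A_diff: "x \<in> D \<Longrightarrow> y \<in> D \<Longrightarrow> A (x - y) = A x - A y"
  using A_add[of x "(-1) *\<^sub>C y"] scaleC_closed[of y "-1"] A_scaleC[of y "-1"] by simp

text \<open>\<open>A\<close> is minus an adjoint, and the identities that define an adjoint survive
  limits. This later places a limit of approximate eigenvectors in \<open>D\<close>.\<close>

lemma A_closed:
  assumes "\<And>n. x n \<in> D" and "x \<longlonglongrightarrow> y" and "(\<lambda>n. A (x n)) \<longlonglongrightarrow> z"
  shows "y \<in> D \<and> A y = z"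
proof -
  have "cinner (A u) y = cinner u (- z)" if "u \<in> D" for u
  proof (rule LIMSEQ_unique)
    show "(\<lambda>n. cinner (A u) (x n)) \<longlonglongrightarrow> cinner (A u) y"
      using assms(2) by (rule tendsto_cinner_right)
    have "(\<lambda>n. cinner u (- A (x n))) \<longlonglongrightarrow> cinner u (- z)"
      using assms(3) by (intro tendsto_cinner_right tendsto_minus)
    then show "(\<lambda>n. cinner (A u) (x n)) \<longlonglongrightarrow> cinner u (- z)"
      using that assms(1) by (simp add: skew cinner_minus_right)
  qed
  then show ?thesis
    using adjoint_iff[of y "- z"] by (metis minus_minus)
qed

lemma Re_cinner_A:
  assumes "x \<in> D" shows "Re (cinner (A x) x) = 0"
proof -
  have "cinner (A x) x = - cnj (cinner (A x) x)"
    using skew[OF assms assms] cinner_commute[of x "A x"] by simp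
  then show ?thesis
    by (metis add_0 cnj.simps(1) diff_0 equal_neg_zero uminus_complex.simps(1))
qed

lemma Re_eigenvalue:
  assumes "eigenvalue D A l" shows "Re l = 0"
proof -
  obtain x where x: "x \<in> D" "x \<noteq> 0" "A x = l *\<^sub>C x"
    using assms by (auto simp: eigenvalue_def)
  then have "Re (l * of_real ((norm x)\<^sup>2)) = 0"
    using Re_cinner_A[of x] by (simp add: cinner_scaleC_left cinner_self)
  then show ?thesis
    using x by simp
qed

lemma Re_spectrum: "l \<in> S \<Longrightarrow> Re l = 0"
  using Re_eigenvalue spectrum_eigenvalue by blast

lemma cnj_spectrum: "l \<in> S \<Longrightarrow> cnj l = - l"
  using Re_spectrum[of l] by (simp add: complex_eq_iff)

section \<open>Algebra of the resolvent\<close>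

lemma
  assumes "z \<notin> S"
  shows bij_resolvent: "bij_betw (\<lambda>x. z *\<^sub>C x - A x) D UNIV"
    and bounded_clinear_resolvent: "bounded_clinear (R z)"
  using assms by (auto simp: spectrum_def resolvent_set_def)

lemma resolvent_mem: "z \<notin> S \<Longrightarrow> R z x \<in> D"
  unfolding resolvent_def using bij_resolvent[of z]
  by (metis UNIV_I bij_betw_imp_surj_on inv_into_into)

lemma resolvent_right: "z \<notin> S \<Longrightarrow> z *\<^sub>C R z x - A (R z x) = x"
  unfolding resolvent_def using bij_resolvent[of z]
  by (metis (lifting) UNIV_I bij_betw_inv_into_right)

lemma resolvent_left: "z \<notin> S \<Longrightarrow> x \<in> D \<Longrightarrow> R z (z *\<^sub>C x - A x) = x"
  unfolding resolvent_def using bij_resolvent[of z] bij_betw_inv_into_left by fastforce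

lemma A_resolvent: "z \<notin> S \<Longrightarrow> A (R z x) = z *\<^sub>C R z x - x"
  using resolvent_right[of z x] by (simp add: algebra_simps)

lemma bounded_linear_resolvent: "z \<notin> S \<Longrightarrow> bounded_linear (R z)"
  using bounded_clinear_resolvent by (auto simp: bounded_clinear_def)

lemma resolvent_scaleC: "z \<notin> S \<Longrightarrow> R z (a *\<^sub>C x) = a *\<^sub>C R z x"
  using bounded_clinear_resolvent by (auto simp: bounded_clinear_def)

lemma resolvent_add: "z \<notin> S \<Longrightarrow> R z (x + y) = R z x + R z y"
  using bounded_linear_resolvent bounded_linear.linear linear_add by blast

lemma resolvent_diff: "z \<notin> S \<Longrightarrow> R z (x - y) = R z x - R z y"
  using bounded_linear_resolvent bounded_linear.linear linear_diff by blast

lemma eigenvalue_spectrum: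
  assumes "eigenvalue D A l" shows "l \<in> S"
proof (rule ccontr)
  assume "l \<notin> S"
  moreover obtain x where x: "x \<in> D" "x \<noteq> 0" "A x = l *\<^sub>C x"
    using assms by (auto simp: eigenvalue_def)
  ultimately have "R l 0 = x"
    using resolvent_left[of l x] by simp
  then show False
    using x resolvent_scaleC[OF \<open>l \<notin> S\<close>, of 0 0] by simp
qed

lemma resolvent_identity:
  assumes "z \<notin> S" "w \<notin> S"
  shows "R z x - R w x = (w - z) *\<^sub>C R z (R w x)"
proof -
  have "z *\<^sub>C R w x - A (R w x) = x - (w - z) *\<^sub>C R w x"
    using A_resolvent[OF assms(2), of x] by (simp add: scaleC_diff_left algebra_simps)
  then have "R w x = R z (x - (w - z) *\<^sub>C R w x)"
    using resolvent_left[OF assms(1) resolvent_mem[OF assms(2)]] by metis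
  also have "\<dots> = R z x - (w - z) *\<^sub>C R z (R w x)"
    using assms by (simp add: resolvent_diff resolvent_scaleC)
  finally show ?thesis
    by (simp add: algebra_simps)
qed

text \<open>The adjoint of \<open>z - A\<close> is \<open>cnj z + A\<close>, which is minus the
  shift by \<open>- cnj z\<close>. The adjoint resolvent therefore sits at the reflection of
  \<open>z\<close> in the imaginary axis.\<close>

lemma cinner_resolvent_left:
  assumes "z \<notin> S" "- cnj z \<notin> S"
  shows "cinner (R z x) y = - cinner x (R (- cnj z) y)"
proof -
  define u v where "u = R z x" and "v = R (- cnj z) y"
  have u: "u \<in> D" "x = z *\<^sub>C u - A u" and v: "v \<in> D" "y = (- cnj z) *\<^sub>C v - A v"
    using assms by (simp_all add: u_def v_def resolvent_mem resolvent_right del: complex_vector.scale_minus_left)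
  have "cinner u y = - cinner x v"
    unfolding u(2) v(2) using skew[OF u(1) v(1)]
    by (simp add: cinner_diff_left cinner_diff_right cinner_scaleC_left cinner_scaleC_right
        cinner_minus_right scaleC_minus_left)
  then show ?thesis
    by (simp add: u_def v_def)
qed

text \<open>Pair \<open>z u - A u\<close> with \<open>u\<close>: since \<open>cinner (A u) u\<close>
  is imaginary, only \<open>Re z\<close> times the squared norm of \<open>u\<close> remains in the
  real part.\<close>

lemma norm_resolvent_Re:
  assumes "Re z \<noteq> 0" shows "norm (R z x) \<le> norm x / \<bar>Re z\<bar>"
proof -
  have z: "z \<notin> S"
    using assms Re_spectrum by blast
  define u where "u = R z x"
  have u: "u \<in> D" "x = z *\<^sub>C u - A u"
    using z by (auto simp: u_def resolvent_mem resolvent_right)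
  have "Re (cinner x u) = Re z * (norm u)\<^sup>2"
    unfolding u(2) using Re_cinner_A[OF u(1)]
    by (simp add: cinner_diff_left cinner_scaleC_left cinner_self)
  then have "\<bar>Re z\<bar> * (norm u)\<^sup>2 \<le> norm x * norm u"
    using cinner_Cauchy_Schwarz[of x u] abs_Re_le_cmod[of "cinner x u"] by (simp add: abs_mult)
  then have "\<bar>Re z\<bar> * norm u \<le> norm x"
    by (cases "u = 0") (auto simp: power2_eq_square)
  then show ?thesis
    using assms by (simp add: u_def field_simps)
qed

section \<open>Local boundedness and holomorphy of the resolvent\<close>

lemma resolvent_local_bound:
  assumes "z0 \<notin> S"
  obtains d K where "d > 0" "K > 0"
    "\<And>z. cmod (z - z0) < d \<Longrightarrow> z \<notin> S"
    "\<And>z x. cmod (z - z0) < d \<Longrightarrow> norm (R z x) \<le> K * norm x"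
proof -
  obtain K where K: "K > 0" "\<And>x. norm (R z0 x) \<le> norm x * K"
    using bounded_linear.pos_bounded[OF bounded_linear_resolvent[OF assms]] by auto
  \<comment> \<open>Half of the radius \<open>1 / K\<close>: the perturbation of \<open>R z0\<close>
    then has norm at most 1/2 and can be absorbed.\<close>
  define d where "d = 1 / (2 * K)"
  have half: "norm (R z0 ((z0 - z) *\<^sub>C x)) \<le> norm x / 2" if "cmod (z - z0) < d" for z x
  proof -
    have "norm (R z0 ((z0 - z) *\<^sub>C x)) \<le> d * norm x * K"
      by (rule order_trans[OF K(2)])
        (use that K(1) in \<open>auto simp: norm_minus_commute intro!: mult_right_mono\<close>)
    then show ?thesis
      using K(1) by (simp add: d_def)
  qed
  \<comment> \<open>A Neumann series is avoided: points of \<open>S\<close> are eigenvalues, and an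
    eigenvector at \<open>z\<close> would be a fixed point of a map that halves norms.\<close>
  have notin: "z \<notin> S" if "cmod (z - z0) < d" for z
  proof
    assume "z \<in> S"
    then obtain x where x: "x \<in> D" "x \<noteq> 0" "A x = z *\<^sub>C x"
      using spectrum_eigenvalue eigenvalue_def by blast
    then have "R z0 ((z0 - z) *\<^sub>C x) = x"
      using resolvent_left[OF assms, of x] by (simp add: scaleC_diff_left)
    then show False
      using half[OF that, of x] x by auto
  qed
  have "norm (R z x) \<le> 2 * K * norm x" if "cmod (z - z0) < d" for z x
  proof -
    define y where "y = R z x"
    have y: "y \<in> D" "x = z *\<^sub>C y - A y"
      using notin[OF that] by (auto simp: y_def resolvent_mem resolvent_right)
    have "z0 *\<^sub>C y - A y = x + (z0 - z) *\<^sub>C y"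
      by (simp add: y(2) scaleC_diff_left)
    then have "y = R z0 x + R z0 ((z0 - z) *\<^sub>C y)"
      using resolvent_left[OF assms y(1)] resolvent_add[OF assms] by metis
    then have "norm y \<le> norm x * K + norm y / 2"
      using norm_triangle_ineq[of "R z0 x" "R z0 ((z0 - z) *\<^sub>C y)"] K(2)[of x] half[OF that, of y]
      by simp
    then show ?thesis
      by (simp add: y_def field_simps)
  qed
  then show thesis
    using that[of d "2 * K"] K notin by (simp add: d_def)
qed

lemma open_resolvent_set: "open (- S)"
proof (rule openI)
  fix z assume "z \<in> - S"
  then obtain d where "d > 0" "\<And>w. cmod (w - z) < d \<Longrightarrow> w \<notin> S"
    using resolvent_local_bound[of z] by (metis ComplD)
  then show "\<exists>e>0. ball z e \<subseteq> - S"
    by (intro exI[of _ d]) (auto simp: dist_norm norm_minus_commute)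
qed

text \<open>By the resolvent identity the difference quotient at \<open>z0\<close> is
  \<open>- cinner (R z w) y\<close> with \<open>w = R z0 x\<close>, so pointwise continuity of the
  resolvent at \<open>z0\<close> is enough.\<close>

lemma holomorphic_resolvent: "(\<lambda>z. cinner (R z x) y) holomorphic_on - S"
proof (rule holomorphic_onI)
  fix z0 assume "z0 \<in> - S"
  then have z0: "z0 \<notin> S"
    by simp
  obtain d K where d: "d > 0" "K > 0" "\<And>z. cmod (z - z0) < d \<Longrightarrow> z \<notin> S"
    "\<And>z x. cmod (z - z0) < d \<Longrightarrow> norm (R z x) \<le> K * norm x"
    using resolvent_local_bound[OF z0] by metis
  have near: "\<forall>\<^sub>F z in at z0. cmod (z - z0) < d"
    using d(1) by (auto simp: eventually_at dist_norm intro!: exI[of _ d])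
  define w where "w = R z0 x"
  have cont: "((\<lambda>z. R z w) \<longlongrightarrow> R z0 w) (at z0)"
  proof (rule LIM_zero_cancel, rule Lim_null_comparison)
    show "\<forall>\<^sub>F z in at z0. norm (R z w - R z0 w) \<le> cmod (z0 - z) * (K * norm (R z0 w))"
      using near
    proof eventually_elim
      case (elim z)
      then show ?case
        using d(4)[OF elim, of "R z0 w"]
        by (simp add: resolvent_identity[OF d(3)[OF elim] z0] mult_left_mono)
    qed
    show "((\<lambda>z. cmod (z0 - z) * (K * norm (R z0 w))) \<longlongrightarrow> 0) (at z0)"
      by (auto intro!: tendsto_eq_intros)
  qed
  have "((\<lambda>z. (cinner (R z x) y - cinner (R z0 x) y) / (z - z0)) \<longlongrightarrow> - cinner (R z0 w) y) (at z0)"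
  proof (rule Lim_transform_eventually)
    show "((\<lambda>z. - cinner (R z w) y) \<longlongrightarrow> - cinner (R z0 w) y) (at z0)"
      by (intro tendsto_minus tendsto_cinner_left cont)
    have "\<forall>\<^sub>F z in at z0. z \<noteq> z0"
      by (simp add: eventually_at_filter)
    with near show "\<forall>\<^sub>F z in at z0. - cinner (R z w) y
        = (cinner (R z x) y - cinner (R z0 x) y) / (z - z0)"
    proof eventually_elim
      case (elim z)
      have "cinner (R z x) y - cinner (R z0 x) y = (z0 - z) * cinner (R z w) y"
        using resolvent_identity[OF d(3)[OF elim(1)] z0, of x]
        by (metis cinner_diff_left cinner_scaleC_left w_def)
      then show ?case
        using elim(2) by (simp add: field_simps)
    qed
  qed
  then have "((\<lambda>z. cinner (R z x) y) has_field_derivative - cinner (R z0 w) y) (at z0)"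
    by (simp add: has_field_derivative_iff)
  then show "(\<lambda>z. cinner (R z x) y) field_differentiable at z0 within - S"
    using field_differentiable_at_within field_differentiable_def by blast
qed

section \<open>Growth of the resolvent near an isolated point of the spectrum\<close>

lemma skew_shift:
  assumes "Re p = 0" "x \<in> D" "y \<in> D"
  shows "inner (p *\<^sub>C x - A x) y = - inner x (p *\<^sub>C y - A y)"
proof -
  have "cnj p = - p"
    using assms(1) by (simp add: complex_eq_iff)
  then show ?thesis
    using skew[OF assms(2,3)]
    by (simp add: inner_eq_Re_cinner cinner_diff_left cinner_diff_right cinner_scaleC_left
        cinner_scaleC_right)
qed

text \<open>
  Otherwise let \<open>m < d\<close> be the infimum of the norm of \<open>T = p - A\<close> over the unit sphere of \<open>D\<close>. Then
  $\|Tx\|^2 - m^2\|x\|^2$ is a positive semidefinite form, and for an almost minimising \<open>x\<close> it becomes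
  negative in the direction of $y = (T^2 + m^2)^{-1}x$.
\<close>

lemma norm_shift_ge:
  assumes p: "Re p = 0" and d: "\<And>l. l \<in> S \<Longrightarrow> d \<le> cmod (l - p)" and x: "x \<in> D"
  shows "d * norm x \<le> norm (p *\<^sub>C x - A x)"
proof (rule ccontr)
  define T where "T = (\<lambda>x. p *\<^sub>C x - A x)"
  assume "\<not> ?thesis"
  then have small: "norm (T x) < d * norm x"
    by (simp add: T_def)
  then have "x \<noteq> 0"
    using A_0 by (auto simp: T_def)
  have T_add: "T (u + v) = T u + T v" if "u \<in> D" "v \<in> D" for u v
    using that by (simp add: T_def A_add scaleC_add_right)
  have T_scaleR: "T (r *\<^sub>R u) = r *\<^sub>R T u" "r *\<^sub>R u \<in> D" if "u \<in> D" for r u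
    using that scaleC_closed[OF that]
    by (simp_all add: T_def A_scaleC scaleR_scaleC scaleC_diff_right scaleC_scaleC mult.commute)
  define N where "N = {norm (T u) |u. u \<in> D \<and> norm u = 1}"
  define m where "m = Inf N"
  have bdd: "bdd_below N"
    by (rule bdd_belowI[of _ 0]) (auto simp: N_def)
  have memN: "norm (T u) / norm u \<in> N" if "u \<in> D" "u \<noteq> 0" for u
    unfolding N_def using that T_scaleR[OF that(1), of "1 / norm u"]
    by (auto intro!: exI[of _ "(1 / norm u) *\<^sub>R u"])
  have "m \<ge> 0"
    unfolding m_def using memN[OF x \<open>x \<noteq> 0\<close>] by (intro cInf_greatest) (auto simp: N_def)
  have "m * norm x \<le> norm (T x)"
    using cInf_lower[OF memN[OF x \<open>x \<noteq> 0\<close>] bdd] \<open>x \<noteq> 0\<close>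
    by (simp add: m_def field_simps)
  from le_less_trans[OF this small] have "m < d"
    by (rule mult_right_less_imp_less) simp
  define a where "a = (\<lambda>u. (norm (T u))\<^sup>2 - m\<^sup>2 * (norm u)\<^sup>2)"
  have a_nonneg: "a u \<ge> 0" if "u \<in> D" for u
  proof (cases "u = 0")
    case True
    then show ?thesis
      using A_0 by (simp add: a_def T_def)
  next
    case False
    then have "m * norm u \<le> norm (T u)"
      using cInf_lower[OF memN[OF that False] bdd] by (simp add: m_def field_simps)
    then show ?thesis
      using power_mono[of "m * norm u" "norm (T u)" 2] \<open>m \<ge> 0\<close>
      by (simp add: a_def power_mult_distrib)
  qed
  \<comment> \<open>\<open>T\<^sup>2 + m\<^sup>2\<close> factors into \<open>q1 - A\<close> and
    \<open>q2 - A\<close>. Both shifts have distance \<open>m < d\<close> from \<open>p\<close>,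
    hence lie outside \<open>S\<close>, and the inverse is a product of two resolvents.\<close>
  define q1 q2 where "q1 = p + \<i> * of_real m" and "q2 = p - \<i> * of_real m"
  have q: "q1 \<notin> S" "q2 \<notin> S"
    using d[of q1] d[of q2] \<open>m < d\<close> \<open>m \<ge> 0\<close> by (auto simp: q1_def q2_def norm_mult)
  obtain K1 where K1: "K1 > 0" "\<And>x. norm (R q1 x) \<le> norm x * K1"
    using bounded_linear.pos_bounded[OF bounded_linear_resolvent[OF q(1)]] by auto
  obtain K2 where K2: "K2 > 0" "\<And>x. norm (R q2 x) \<le> norm x * K2"
    using bounded_linear.pos_bounded[OF bounded_linear_resolvent[OF q(2)]] by auto
  \<comment> \<open>\<open>K\<close> will bound \<open>a y\<close>. A step of length
    \<open>1 / K\<close> along \<open>y\<close> changes \<open>a u\<close> to at most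
    \<open>a u - 2 / K + 1 / K\<close>, which is why \<open>u\<close> is chosen with
    \<open>a u < 1 / K\<close>.\<close>
  define K where "K = (K2 + m * K2 * K1)\<^sup>2"
  have "K > 0"
    unfolding K_def using K1(1) K2(1) \<open>m \<ge> 0\<close> by (intro zero_less_power add_pos_nonneg) auto
  have "\<exists>v\<in>N. v < sqrt (m\<^sup>2 + 1 / K)"
  proof (rule cInf_lessD)
    show "N \<noteq> {}"
      using memN[OF x \<open>x \<noteq> 0\<close>] by auto
    have "sqrt (m\<^sup>2) < sqrt (m\<^sup>2 + 1 / K)"
      using \<open>K > 0\<close> by (subst real_sqrt_less_iff) simp
    then show "Inf N < sqrt (m\<^sup>2 + 1 / K)"
      using \<open>m \<ge> 0\<close> by (simp add: m_def)
  qed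
  then obtain u where u: "u \<in> D" "norm u = 1" "norm (T u) < sqrt (m\<^sup>2 + 1 / K)"
    by (auto simp: N_def)
  have "a u < 1 / K"
  proof -
    have "(norm (T u))\<^sup>2 < (sqrt (m\<^sup>2 + 1 / K))\<^sup>2"
      using u(3) by (intro power_strict_mono) auto
    then show ?thesis
      using \<open>K > 0\<close> u(2) by (simp add: a_def)
  qed
  define w y where "w = R q2 u" and "y = R q1 w"
  have w: "w \<in> D" "T w = u + (\<i> * of_real m) *\<^sub>C w"
    using q A_resolvent[OF q(2), of u]
    by (simp_all add: w_def resolvent_mem T_def q2_def scaleC_diff_left)
  have y: "y \<in> D" "T y = w - (\<i> * of_real m) *\<^sub>C y"
    using q A_resolvent[OF q(1), of w]
    by (simp_all add: y_def resolvent_mem T_def q1_def scaleC_add_left)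
  have Ty: "T y \<in> D"
    using w(1) y scaleC_closed diff_closed by simp
  have TTy: "T (T y) = u - m\<^sup>2 *\<^sub>R y"
  proof -
    have "T (T y) = T (w - (\<i> * of_real m) *\<^sub>C y)"
      by (simp only: y(2))
    also have "\<dots> = T w - (\<i> * of_real m) *\<^sub>C T y"
      using w(1) y(1)
      by (simp add: T_def A_diff A_scaleC scaleC_closed scaleC_diff_right scaleC_scaleC
          algebra_simps)
    also have "\<dots> = u + (\<i> * of_real m) *\<^sub>C ((\<i> * of_real m) *\<^sub>C y)"
      by (simp add: w(2) y(2) scaleC_diff_right)
    also have "\<dots> = u - m\<^sup>2 *\<^sub>R y"
    proof -
      have "(\<i> * of_real m) * (\<i> * of_real m) = - complex_of_real (m\<^sup>2)"
        by (simp add: complex_eq_iff power2_eq_square)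
      then show ?thesis
        by (simp only: scaleC_scaleC scaleR_scaleC scaleC_minus_left add_uminus_conv_diff)
    qed
    finally show ?thesis .
  qed
  have "inner (T u) (T y) = - inner u (T (T y))"
    using skew_shift[OF p u(1) Ty] by (simp only: T_def)
  \<comment> \<open>By skewness the left side is minus the product of \<open>u\<close> with
    \<open>T (T y) + m\<^sup>2 *\<^sub>R y\<close>, and this vector is \<open>u\<close>, of norm
    1.\<close>
  then have cross: "inner (T u) (T y) - m\<^sup>2 * inner u y = - 1"
    using u(2) by (simp add: TTy inner_diff_right dot_square_norm)
  have "norm (T y) \<le> K2 + m * K2 * K1"
  proof -
    have "norm w \<le> K2"
      using K2(2)[of u] u(2) by (simp add: w_def)
    moreover have "norm y \<le> norm w * K1"
      unfolding y_def by (rule K1(2))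
    then have "norm y \<le> K2 * K1"
      using mult_right_mono[OF \<open>norm w \<le> K2\<close>, of K1] K1(1) by linarith
    then have "m * norm y \<le> m * (K2 * K1)"
      using \<open>m \<ge> 0\<close> by (rule mult_left_mono)
    moreover have "norm (T y) \<le> norm w + m * norm y"
      unfolding y(2) using norm_triangle_ineq4[of w "(\<i> * of_real m) *\<^sub>C y"] \<open>m \<ge> 0\<close>
      by (simp add: norm_mult)
    ultimately show ?thesis
      by simp
  qed
  then have "(norm (T y))\<^sup>2 \<le> K"
    unfolding K_def by (intro power_mono) auto
  then have "a y \<le> K"
    unfolding a_def using mult_nonneg_nonneg[OF zero_le_power2 zero_le_power2, of m "norm y"]
    by linarith
  have "a (u + (1 / K) *\<^sub>R y) = a u + 2 / K * (inner (T u) (T y) - m\<^sup>2 * inner u y) + a y / K\<^sup>2"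
    unfolding a_def power2_norm_eq_inner using u(1) y(1) \<open>K > 0\<close>
    by (simp add: T_add T_scaleR inner_add_left inner_add_right
        inner_commute[of "T y" "T u"] inner_commute[of y u] power2_eq_square field_simps)
  also have "\<dots> \<le> a u - 2 / K + K / K\<^sup>2"
    unfolding cross using \<open>a y \<le> K\<close> by (simp add: divide_right_mono)
  also have "\<dots> < 0"
    using \<open>a u < 1 / K\<close> \<open>K > 0\<close> by (simp add: power2_eq_square)
  finally show False
    using a_nonneg[of "u + (1 / K) *\<^sub>R y"] u(1) y(1) by (simp add: T_scaleR add_closed)
qed

text \<open>The imaginary part of \<open>z - l\<close> is handled by \<open>norm_shift_ge\<close>.
  The real part adds a vector orthogonal to the shifted one, because an imaginary shift of
  \<open>A\<close> is still skew. Pythagoras recombines both into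
  \<open>cmod (z - l)\<close>.\<close>

lemma resolvent_bound_isolated:
  assumes "l \<in> S"
  obtains r where "r > 0" "\<And>z. z \<noteq> l \<Longrightarrow> cmod (z - l) < r \<Longrightarrow> z \<notin> S"
    "\<And>z x. z \<noteq> l \<Longrightarrow> cmod (z - l) < r \<Longrightarrow> cmod (z - l) * norm (R z x) \<le> norm x"
proof -
  obtain r where r: "r > 0" "\<And>z. z \<in> S \<Longrightarrow> cmod (l - z) < r \<Longrightarrow> z = l"
    using isolated[OF assms] unfolding isolated_in_dist_Ex_iff dist_norm by blast
  have notin: "z \<notin> S" if "z \<noteq> l" "cmod (z - l) < r" for z
    using r(2)[of z] that by (auto simp: norm_minus_commute)
  \<comment> \<open>Within \<open>r / 2\<close>, the point \<open>l\<close> is the nearest spectral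
    point to its vertical translate \<open>p\<close>: the others are at least \<open>r\<close> away
    from \<open>l\<close>, and \<open>p\<close> is less than \<open>r / 2\<close> away from
    it.\<close>
  have "cmod (z - l) * norm (R z x) \<le> norm x" if z: "z \<noteq> l" "cmod (z - l) < r / 2" for z x
  proof -
    define p where "p = l + \<i> * of_real (Im (z - l))"
    define y where "y = R z x"
    have zS: "z \<notin> S"
      using notin[of z] z r(1) by auto
    have y: "y \<in> D" "x = z *\<^sub>C y - A y"
      using zS by (auto simp: y_def resolvent_mem resolvent_right)
    have Rep: "Re p = 0"
      using Re_spectrum[OF assms] by (simp add: p_def)
    have "\<bar>Im (z - l)\<bar> \<le> cmod (k - p)" if "k \<in> S" for k
    proof (cases "k = l")
      case False
      then have "r \<le> cmod (l - k)"
        using r(2)[OF that] by force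
      moreover have "cmod (p - l) = \<bar>Im (z - l)\<bar>"
        by (simp add: p_def norm_mult flip: of_real_diff)
      then have "cmod (l - k) \<le> cmod (k - p) + \<bar>Im (z - l)\<bar>"
        using norm_triangle_ineq[of "k - p" "p - l"] by (simp add: norm_minus_commute)
      moreover have "\<bar>Im (z - l)\<bar> < r / 2"
        using abs_Im_le_cmod[of "z - l"] z(2) by linarith
      ultimately show ?thesis
        by linarith
    qed (simp add: p_def norm_mult flip: of_real_diff)
    then have "\<bar>Im (z - l)\<bar> * norm y \<le> norm (p *\<^sub>C y - A y)"
      using y(1) Rep by (intro norm_shift_ge)
    then have 1: "(Im (z - l))\<^sup>2 * (norm y)\<^sup>2 \<le> (norm (p *\<^sub>C y - A y))\<^sup>2"
      using power_mono[of "\<bar>Im (z - l)\<bar> * norm y" _ 2] by (simp add: power_mult_distrib)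
    have "z = p + of_real (Re (z - l))"
      using Re_spectrum[OF assms] by (simp add: p_def complex_eq_iff)
    then have "x = (p *\<^sub>C y - A y) + Re (z - l) *\<^sub>R y"
      unfolding y(2) scaleR_scaleC by (metis (no_types) add.commute add_diff_eq scaleC_add_left)
    moreover have "inner (p *\<^sub>C y - A y) y = 0"
      using skew_shift[OF Rep y(1) y(1)] by (simp add: inner_commute)
    ultimately have "(norm x)\<^sup>2 = (norm (p *\<^sub>C y - A y))\<^sup>2 + (Re (z - l))\<^sup>2 * (norm y)\<^sup>2"
      using norm_add_Pythagorean[of "p *\<^sub>C y - A y" "Re (z - l) *\<^sub>R y"]
      by (simp add: orthogonal_def power_mult_distrib)
    then have "(cmod (z - l) * norm y)\<^sup>2 \<le> (norm x)\<^sup>2"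
      using 1 by (simp add: power_mult_distrib cmod_power2 distrib_right)
    then show ?thesis
      by (simp add: y_def power2_le_iff_abs_le)
  qed
  then show thesis
    using that[of "r / 2"] notin r(1) by auto
qed

section \<open>Completeness of the eigenvectors\<close>

text \<open>
  The vectors $u_t = t(l + t - A)^{-1}x$ form a Cauchy family as $t \to 0$, because
  $\langle u_t, u_s\rangle$ is a convex combination of $f(l + t)$ and $f(l - s)$ for the function
  $f(z) = (z - l)\langle (z - A)^{-1}x, x\rangle$, which extends continuously to \<open>l\<close>. Their limit
  lies in the kernel of \<open>l - A\<close>.
\<close>

lemma resolvent_residue_eq_0:
  assumes l: "l \<in> S" and orth: "\<And>v. v \<in> D \<Longrightarrow> A v = l *\<^sub>C v \<Longrightarrow> cinner v x = 0"
  shows "((\<lambda>z. (z - l) * cinner (R z x) x) \<longlongrightarrow> 0) (at l)"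
proof -
  define f where "f = (\<lambda>z. (z - l) * cinner (R z x) x)"
  obtain r where r: "r > 0" "\<And>z. z \<noteq> l \<Longrightarrow> cmod (z - l) < r \<Longrightarrow> z \<notin> S"
    "\<And>z x. z \<noteq> l \<Longrightarrow> cmod (z - l) < r \<Longrightarrow> cmod (z - l) * norm (R z x) \<le> norm x"
    using resolvent_bound_isolated[OF l] by metis
  have "(\<lambda>z. cinner (R z x) x) holomorphic_on ball l r - {l}"
    by (rule holomorphic_on_subset[OF holomorphic_resolvent])
      (use r(2) in \<open>auto simp: dist_norm norm_minus_commute\<close>)
  then have hol: "f holomorphic_on ball l r - {l}"
    unfolding f_def by (intro holomorphic_intros)
  have "cmod (f z) \<le> norm x * norm x" if "z \<noteq> l" "cmod (z - l) < r" for z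
  proof -
    have "cmod (f z) \<le> cmod (z - l) * (norm (R z x) * norm x)"
      unfolding f_def by (simp add: norm_mult mult_left_mono cinner_Cauchy_Schwarz)
    also have "\<dots> \<le> norm x * norm x"
      using mult_right_mono[OF r(3)[OF that, of x], of "norm x"] by (simp add: mult.assoc)
    finally show ?thesis .
  qed
  then have "\<forall>\<^sub>F z in at l. cmod (f z) \<le> norm x * norm x"
    using r(1) by (auto simp: eventually_at dist_norm intro!: exI[of _ r])
  then obtain g where g: "g holomorphic_on ball l r" "\<And>z. z \<in> ball l r - {l} \<Longrightarrow> g z = f z"
    using holomorphic_on_extend_bounded[OF hol] r(1) by auto
  define c where "c = g l"
  have "isCont g l"
    using g(1) r(1) by (metis centre_in_ball continuous_on_eq_continuous_at
        holomorphic_on_imp_continuous_on open_ball)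
  then have "(g \<longlongrightarrow> c) (at l)"
    by (simp add: c_def isCont_def)
  then have f_lim: "(f \<longlongrightarrow> c) (at l)"
    by (rule Lim_transform_within_open[of _ _ _ _ "ball l r"]) (use g(2) r(1) in auto)
  \<comment> \<open>The offset 2 keeps \<open>t 0\<close> strictly below \<open>r\<close>.\<close>
  define t where "t = (\<lambda>n. r / (real n + 2))"
  have t: "0 < t n" "t n < r" for n
    using r(1) by (auto simp: t_def field_simps intro!: add_pos_nonneg)
  have t_lim: "t \<longlonglongrightarrow> 0"
    unfolding t_def by real_asymp
  have tS: "l + of_real (t n) \<notin> S" "l - of_real (t n) \<notin> S" for n
    using t[of n] r(2)[of "l + of_real (t n)"] r(2)[of "l - of_real (t n)"] by auto
  define u where "u = (\<lambda>n. t n *\<^sub>R R (l + of_real (t n)) x)"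
  have uu: "cinner (u n) (u m) =
      (of_real (t m) * f (l + of_real (t n)) + of_real (t n) * f (l - of_real (t m)))
        / (of_real (t n + t m))" for n m
  proof -
    \<comment> \<open>\<open>q\<close> is the reflection of \<open>l + t m\<close> in the imaginary
      axis. Moving the second resolvent across the product puts it at \<open>q\<close>, and the
      resolvent identity with \<open>p - q = t n + t m\<close> splits the resulting product of
      resolvents.\<close>
    define p q where "p = l + of_real (t n)" and "q = l - of_real (t m)"
    have q: "- cnj q = l + of_real (t m)"
      using cnj_spectrum[OF l] by (simp add: q_def)
    have pq: "p \<notin> S" "q \<notin> S" "- cnj q \<notin> S" "- cnj (- cnj q) = q"
      unfolding q by (simp_all add: p_def q_def tS cnj_spectrum[OF l])
    from q have "cinner (u n) (u m) = of_real (t n * t m) * cinner (R p x) (R (- cnj q) x)"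
      by (simp add: u_def p_def scaleR_scaleC cinner_scaleC_left cinner_scaleC_right)
    also have "cinner (R p x) (R (- cnj q) x) = - cinner (R q (R p x)) x"
      using cinner_resolvent_left[of q "R p x" x] pq by simp
    also have "cinner (R q (R p x)) x = (cinner (R q x) x - cinner (R p x) x) / (p - q)"
    proof -
      have "p - q \<noteq> 0"
        using t[of n] t[of m] by (simp add: p_def q_def flip: of_real_add)
      then show ?thesis
        using arg_cong[OF resolvent_identity[OF pq(2,1), of x], of "\<lambda>v. cinner v x"]
        by (simp add: cinner_diff_left cinner_scaleC_left)
    qed
    also have "p - q = of_real (t n + t m)"
      by (simp add: p_def q_def)
    finally show ?thesis
      using t[of n] t[of m] unfolding f_def p_def[symmetric] q_def[symmetric]
      by (simp add: p_def q_def field_simps) (simp only: minus_divide_left minus_diff_eq)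
  qed
  have uu_lim: "\<exists>M. \<forall>m\<ge>M. \<forall>n\<ge>M. cmod (cinner (u m) (u n) - c) < e" if "e > 0" for e
  proof -
    obtain d where d: "d > 0" "\<And>z. z \<noteq> l \<Longrightarrow> cmod (z - l) < d \<Longrightarrow> cmod (f z - c) < e"
      using LIM_D[OF f_lim \<open>e > 0\<close>] by auto
    obtain M where M: "\<And>n. n \<ge> M \<Longrightarrow> t n < d"
      using order_tendstoD(2)[OF t_lim d(1)] by (auto simp: eventually_sequentially)
    have "cmod (cinner (u n) (u m) - c) < e" if nm: "n \<ge> M" "m \<ge> M" for n m
    proof -
      define p q where "p = f (l + of_real (t n)) - c" and "q = f (l - of_real (t m)) - c"
      have pq: "cmod p < e" "cmod q < e"
        unfolding p_def q_def using M[OF nm(1)] M[OF nm(2)] t[of n] t[of m] by (auto intro!: d(2))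
      have pos: "t n + t m > 0"
        using t[of n] t[of m] by simp
      then have "of_real (t n + t m) \<noteq> (0::complex)"
        by (metis less_irrefl of_real_eq_0_iff)
      then have "cinner (u n) (u m) - c = (of_real (t m) * p + of_real (t n) * q) / of_real (t n + t m)"
        unfolding uu p_def q_def by (simp add: field_simps)
      then have "cmod (cinner (u n) (u m) - c)
          = cmod (of_real (t m) * p + of_real (t n) * q) / (t n + t m)"
        using pos by (simp only: norm_divide norm_of_real abs_of_pos)
      also have "\<dots> \<le> (t m * cmod p + t n * cmod q) / (t n + t m)"
        using pos t[of n] t[of m] norm_triangle_ineq[of "of_real (t m) * p" "of_real (t n) * q"]
        by (intro divide_right_mono) (auto simp: norm_mult)
      also have "\<dots> < (t m * e + t n * e) / (t n + t m)"
        using pq pos t[of n] t[of m]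
        by (intro divide_strict_right_mono add_strict_mono mult_strict_left_mono) auto
      also have "\<dots> = e"
        using pos by (simp add: field_simps)
      finally show ?thesis .
    qed
    then show ?thesis
      by blast
  qed
  have "Cauchy u"
  proof (rule metric_CauchyI)
    fix e :: real assume "e > 0"
    then obtain M where M: "\<And>n m. n \<ge> M \<Longrightarrow> m \<ge> M \<Longrightarrow> cmod (cinner (u m) (u n) - c) < e\<^sup>2 / 4"
      using uu_lim[of "e\<^sup>2 / 4"] by auto
    have "dist (u m) (u n) < e" if "m \<ge> M" "n \<ge> M" for m n
    proof -
      \<comment> \<open>The four copies of \<open>c\<close> cancel, so each inner product may
        contribute a quarter of the allowance.\<close>
      have "complex_of_real ((norm (u m - u n))\<^sup>2) = (cinner (u m) (u m) - c) - (cinner (u m) (u n) - c)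
          - (cinner (u n) (u m) - c) + (cinner (u n) (u n) - c)"
        unfolding cinner_self[symmetric] by (simp add: cinner_diff_left cinner_diff_right)
      then have "(norm (u m - u n))\<^sup>2 = cmod ((cinner (u m) (u m) - c) - (cinner (u m) (u n) - c)
          - (cinner (u n) (u m) - c) + (cinner (u n) (u n) - c))"
        by (metis norm_of_real abs_of_nonneg zero_le_power2)
      also have "\<dots> \<le> cmod (cinner (u m) (u m) - c) + cmod (cinner (u m) (u n) - c)
          + cmod (cinner (u n) (u m) - c) + cmod (cinner (u n) (u n) - c)"
        by (intro norm_triangle_le norm_triangle_le_diff add_mono order_refl)
      also have "\<dots> < e\<^sup>2 / 4 + e\<^sup>2 / 4 + e\<^sup>2 / 4 + e\<^sup>2 / 4"
        using that by (intro add_strict_mono M)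
      finally show ?thesis
        using \<open>e > 0\<close> by (simp add: dist_norm power_less_imp_less_base)
    qed
    then show "\<exists>M. \<forall>m\<ge>M. \<forall>n\<ge>M. dist (u m) (u n) < e"
      by blast
  qed
  then obtain v where v: "u \<longlonglongrightarrow> v"
    using Cauchy_convergent convergent_def by blast
  have uD: "u n \<in> D" for n
    unfolding u_def scaleR_scaleC by (intro scaleC_closed resolvent_mem tS)
  \<comment> \<open>\<open>A (u n) - l u n\<close> is \<open>t n\<close> times
    \<open>u n - x\<close> and tends to 0, so by closedness the limit \<open>v\<close> lies in the
    kernel of \<open>l - A\<close>. The products \<open>cinner (u n) x\<close> are values of
    \<open>f\<close> on a real ray, so they tend both to \<open>c\<close> and to
    \<open>cinner v x = 0\<close>.\<close>
  have Au: "A (u n) = l *\<^sub>C u n + t n *\<^sub>R u n - t n *\<^sub>R x" for n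
    unfolding u_def scaleR_scaleC
    by (simp add: A_scaleC resolvent_mem tS A_resolvent scaleC_diff_right scaleC_add_left
        scaleC_add_right scaleC_scaleC mult.commute)
  have "(\<lambda>n. A (u n)) \<longlonglongrightarrow> l *\<^sub>C v + 0 *\<^sub>R v - 0 *\<^sub>R x"
    unfolding Au by (intro tendsto_intros v t_lim bounded_linear.tendsto[OF bounded_linear_scaleC_right])
  then have "v \<in> D \<and> A v = l *\<^sub>C v"
    using A_closed[of u v] uD v by simp
  then have "(\<lambda>n. cinner (u n) x) \<longlonglongrightarrow> 0"
    using orth[of v] tendsto_cinner_left[OF v, of x] by simp
  moreover have "(\<lambda>n. cinner (u n) x) \<longlonglongrightarrow> c"
  proof -
    have "(\<lambda>n. f (l + of_real (t n))) \<longlonglongrightarrow> c"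
    proof (rule filterlim_compose[OF f_lim])
      have "(\<lambda>n. l + of_real (t n)) \<longlonglongrightarrow> l + of_real 0"
        by (intro tendsto_intros t_lim)
      moreover have "\<forall>\<^sub>F n in sequentially. l + of_real (t n) \<noteq> l"
        using t(1) by (auto intro!: always_eventually simp: less_imp_neq[symmetric])
      ultimately show "filterlim (\<lambda>n. l + of_real (t n)) (at l) sequentially"
        by (simp add: filterlim_at)
    qed
    moreover have "f (l + of_real (t n)) = cinner (u n) x" for n
      by (simp add: f_def u_def cinner_scaleR_left)
    ultimately show ?thesis
      by simp
  qed
  ultimately have "c = 0"
    using LIMSEQ_unique by blast
  then show ?thesis
    using f_lim by (simp add: f_def)
qed

text \<open>
  All singularities of $F(z) = \langle (z - A)^{-1}x, x\rangle$ are removable, and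
  $|F(z)| \le \|x\|^2/|\mathrm{Re}\,z|$. Since $|z^2 + \rho^2| = 2\rho\,|\mathrm{Re}\,z|$ for
  $|z| = \rho$, the maximum principle gives $|(1 + \rho^2) F(1)| \le 2\rho\|x\|^2$ for large $\rho$.
\<close>

lemma eigenvectors_complete:
  assumes orth: "\<And>l v. v \<in> D \<Longrightarrow> A v = l *\<^sub>C v \<Longrightarrow> cinner v x = 0"
  shows "x = 0"
proof -
  define F where "F = (\<lambda>z. cinner (R z x) x)"
  \<comment> \<open>\<open>Lim\<close> is total, so \<open>G\<close> is defined before any limit is
    known to exist; on \<open>S\<close> the local holomorphic extension supplies it.\<close>
  define G where "G = (\<lambda>z. if z \<in> S then Lim (at z) F else F z)"
  have "G field_differentiable at z" for z
  proof (cases "z \<in> S")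
    case False
    have "F field_differentiable at z"
      using holomorphic_on_imp_differentiable_at[OF holomorphic_resolvent open_resolvent_set] False
      by (auto simp: F_def)
    moreover have "F w = G w" if "w \<in> - S" for w
      using that by (simp add: G_def)
    ultimately show ?thesis
      using False has_field_derivative_transform_within_open[OF _ open_resolvent_set]
      unfolding field_differentiable_def by (metis ComplI)
  next
    case True
    then obtain r where r: "r > 0" "\<And>w. w \<noteq> z \<Longrightarrow> cmod (w - z) < r \<Longrightarrow> w \<notin> S"
      using resolvent_bound_isolated by metis
    have hol: "F holomorphic_on ball z r - {z}"
      unfolding F_def by (rule holomorphic_on_subset[OF holomorphic_resolvent])
        (use r(2) in \<open>auto simp: dist_norm norm_minus_commute\<close>)
    have "((\<lambda>w. (w - z) * F w) \<longlongrightarrow> 0) (at z)"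
      unfolding F_def by (rule resolvent_residue_eq_0[OF True]) (rule orth)
    then have "\<exists>g. g holomorphic_on ball z r \<and> (\<forall>w\<in>ball z r - {z}. g w = F w)"
      using holomorphic_on_extend_lim[OF hol] r(1) by simp
    then obtain g where g: "g holomorphic_on ball z r" "\<And>w. w \<in> ball z r - {z} \<Longrightarrow> g w = F w"
      by blast
    have "isCont g z"
      using g(1) r(1) by (metis centre_in_ball continuous_on_eq_continuous_at
          holomorphic_on_imp_continuous_on open_ball)
    then have "(g \<longlongrightarrow> g z) (at z)"
      by (simp add: isCont_def)
    then have "(F \<longlongrightarrow> g z) (at z)"
      by (rule Lim_transform_within_open[of _ _ _ _ "ball z r"]) (use g(2) r(1) in auto)
    then have "Lim (at z) F = g z"
      by (intro tendsto_Lim) auto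
    then have "g w = G w" if "w \<in> ball z r" for w
      using that r(2)[of w] True g(2)[of w]
      by (cases "w = z") (auto simp: G_def dist_norm norm_minus_commute)
    moreover have "g field_differentiable at z"
      using g(1) r(1) by (intro holomorphic_on_imp_differentiable_at) auto
    ultimately show ?thesis
      using r(1) has_field_derivative_transform_within_open[of g _ z "ball z r" G]
      unfolding field_differentiable_def by (metis centre_in_ball open_ball)
  qed
  then have holG: "G holomorphic_on UNIV"
    by (simp add: holomorphic_on_def)
  have G_bound: "\<bar>Re z\<bar> * cmod (G z) \<le> (norm x)\<^sup>2" for z
  proof (cases "Re z = 0")
    case False
    then have "cmod (G z) \<le> norm (R z x) * norm x"
      using Re_spectrum[of z] by (auto simp: G_def F_def cinner_Cauchy_Schwarz)
    also have "\<dots> \<le> norm x / \<bar>Re z\<bar> * norm x"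
      by (intro mult_right_mono norm_resolvent_Re False) auto
    finally show ?thesis
      using False by (simp add: field_simps power2_eq_square)
  qed simp
  have bound: "(1 + \<rho>\<^sup>2) * cmod (G 1) \<le> 2 * \<rho> * (norm x)\<^sup>2" if "\<rho> \<ge> 1" for \<rho> :: real
  proof -
    define H where "H = (\<lambda>z. (z\<^sup>2 + of_real (\<rho>\<^sup>2)) * G z)"
    have holH: "H holomorphic_on X" for X
      unfolding H_def using holG by (intro holomorphic_intros) (auto intro: holomorphic_on_subset)
    have "cmod (H 1) \<le> 2 * \<rho> * (norm x)\<^sup>2"
    proof (rule maximum_modulus_frontier[where f=H and S="cball 0 \<rho>"])
      fix z assume "z \<in> frontier (cball (0::complex) \<rho>)"
      then have z: "cmod z = \<rho>"
        using that by simp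
      have "z\<^sup>2 + of_real (\<rho>\<^sup>2) = z * of_real (2 * Re z)"
        using complex_norm_square[of z] complex_add_cnj[of z]
        unfolding z by (simp add: power2_eq_square flip: distrib_left)
      then have "cmod (H z) = 2 * \<rho> * (\<bar>Re z\<bar> * cmod (G z))"
        by (simp add: H_def norm_mult z)
      also have "\<dots> \<le> 2 * \<rho> * (norm x)\<^sup>2"
        using that by (intro mult_left_mono G_bound) auto
      finally show "cmod (H z) \<le> 2 * \<rho> * (norm x)\<^sup>2" .
    qed (use that holH holomorphic_on_imp_continuous_on in auto)
    moreover have "cmod (1 + of_real (\<rho>\<^sup>2)) = 1 + \<rho>\<^sup>2"
      by (metis abs_of_nonneg add_nonneg_nonneg norm_of_real of_real_1 of_real_add
          zero_le_one zero_le_power2)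
    ultimately show ?thesis
      by (simp add: H_def norm_mult)
  qed
  have "cmod (G 1) \<le> 0"
  proof (rule tendsto_lowerbound)
    show "((\<lambda>\<rho>::real. 2 * \<rho> * (norm x)\<^sup>2 / (1 + \<rho>\<^sup>2)) \<longlongrightarrow> 0) at_top"
      by real_asymp
    show "\<forall>\<^sub>F \<rho>::real in at_top. cmod (G 1) \<le> 2 * \<rho> * (norm x)\<^sup>2 / (1 + \<rho>\<^sup>2)"
      using eventually_ge_at_top[of 1]
    proof eventually_elim
      case (elim \<rho>)
      have "1 + \<rho>\<^sup>2 > 0"
        by (simp add: add_pos_nonneg)
      then show ?case
        using bound[OF elim] by (simp add: field_simps)
    qed
  qed simp
  have 1: "1 \<notin> S"
    using Re_spectrum[of 1] by auto
  define y where "y = R 1 x"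
  have y: "y \<in> D" "x = y - A y"
    using resolvent_mem[OF 1] resolvent_right[OF 1, of x] by (auto simp: y_def)
  \<comment> \<open>Vanishing at the single point \<open>1\<close> suffices: as
    \<open>x = y - A y\<close>, the real part of \<open>cinner y x\<close> is the squared norm of
    \<open>y\<close>.\<close>
  have "cinner y x = 0"
    using \<open>cmod (G 1) \<le> 0\<close> 1 by (simp add: G_def F_def y_def)
  then have "(norm y)\<^sup>2 = 0"
    unfolding y(2) using Re_cinner_A[OF y(1)] cinner_commute[of y "A y"]
    by (simp add: cinner_diff_right cinner_self complex_eq_iff)
  then show ?thesis
    using y A_0 by simp
qed

end


section \<open>Eigenvector expansion\<close>

text \<open>\<open>observable\<close> is what minimality supplies: an eigenvector orthogonal to
  \<open>b\<close> would make its eigenvalue an invariant zero with input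
  \<open>u = 0\<close>.\<close>

locale skew_adjoint_observable = skew_adjoint_discrete +
  fixes b :: 'a
  assumes observable: "x \<in> D \<Longrightarrow> A x = l *\<^sub>C x \<Longrightarrow> cinner x b = 0 \<Longrightarrow> x = 0"
begin

text \<open>On the spectrum the choice is unique up to a unimodular factor, by
  \<open>eigenvector_multiple\<close>, and the weights \<open>w\<close> do not see this
  factor.\<close>

definition e :: "complex \<Rightarrow> 'a"
  where "e l = (SOME x. x \<in> D \<and> norm x = 1 \<and> A x = l *\<^sub>C x)"

lemma
  assumes "l \<in> S"
  shows e_mem: "e l \<in> D" and norm_e: "norm (e l) = 1" and A_e: "A (e l) = l *\<^sub>C e l"
proof -
  obtain x where x: "x \<in> D" "x \<noteq> 0" "A x = l *\<^sub>C x"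
    using spectrum_eigenvalue[OF assms] by (auto simp: eigenvalue_def)
  define y where "y = complex_of_real (1 / norm x) *\<^sub>C x"
  have "y \<in> D \<and> norm y = 1 \<and> A y = l *\<^sub>C y"
    using x by (simp add: y_def scaleC_closed A_scaleC scaleC_scaleC mult.commute norm_divide)
  then have "e l \<in> D \<and> norm (e l) = 1 \<and> A (e l) = l *\<^sub>C e l"
    unfolding e_def by (rule someI)
  then show "e l \<in> D" "norm (e l) = 1" "A (e l) = l *\<^sub>C e l"
    by auto
qed

lemma cinner_e_e:
  assumes "l \<in> S" "k \<in> S"
  shows "cinner (e l) (e k) = (if l = k then 1 else 0)"
proof -
  have "l * cinner (e l) (e k) = k * cinner (e l) (e k)"
    using skew[OF e_mem e_mem, OF assms] assms
    by (simp add: A_e cinner_scaleC_left cinner_scaleC_right cnj_spectrum)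
  then show ?thesis
    using norm_e[OF assms(1)] by (auto simp: cinner_self)
qed

text \<open>Subtracting the multiple of \<open>e l\<close> with the same product with
  \<open>b\<close> leaves a vector of the eigenspace orthogonal to \<open>b\<close>, which is
  zero.\<close>

lemma eigenvector_multiple:
  assumes v: "v \<in> D" "A v = l *\<^sub>C v" and l: "l \<in> S"
  shows "\<exists>a. v = a *\<^sub>C e l"
proof -
  define a where "a = cinner v b / cinner (e l) b"
  have "cinner (e l) b \<noteq> 0"
    using observable[OF e_mem A_e] norm_e l by force
  then have "cinner (v - a *\<^sub>C e l) b = 0"
    by (simp add: a_def cinner_diff_left cinner_scaleC_left)
  then have "v - a *\<^sub>C e l = 0"
    using v e_mem[OF l] A_e[OF l]
    by (intro observable[where l=l])
      (auto simp: diff_closed scaleC_closed A_diff A_scaleC scaleC_diff_right scaleC_scaleC mult.commute)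
  then show ?thesis
    by auto
qed

lemma norm_sum_e:
  assumes "finite F" "F \<subseteq> S"
  shows "(norm (\<Sum>l\<in>F. a l *\<^sub>C e l))\<^sup>2 = (\<Sum>l\<in>F. (cmod (a l))\<^sup>2)"
  using assms
proof (induction F rule: finite_induct)
  case (insert k F)
  have "cinner (\<Sum>l\<in>F. a l *\<^sub>C e l) (a k *\<^sub>C e k) = 0"
    unfolding cinner_sum_left using insert.hyps insert.prems
    by (intro sum.neutral) (auto simp: cinner_scaleC_left cinner_scaleC_right cinner_e_e subset_iff)
  then have "orthogonal (\<Sum>l\<in>F. a l *\<^sub>C e l) (a k *\<^sub>C e k)"
    by (simp add: orthogonal_def inner_eq_Re_cinner)
  then show ?case
    using insert norm_add_Pythagorean[of "\<Sum>l\<in>F. a l *\<^sub>C e l" "a k *\<^sub>C e k"]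
    by (simp add: norm_e power_mult_distrib add.commute)
qed simp

lemma Bessel:
  assumes "finite F" "F \<subseteq> S"
  shows "(\<Sum>l\<in>F. (cmod (cinner x (e l)))\<^sup>2) \<le> (norm x)\<^sup>2"
proof -
  define p where "p = (\<Sum>l\<in>F. cinner x (e l) *\<^sub>C e l)"
  have "cinner p x = (\<Sum>l\<in>F. of_real ((cmod (cinner x (e l)))\<^sup>2))"
    unfolding p_def cinner_sum_left
    by (intro sum.cong refl cinner_coeff)
  also have "\<dots> = of_real ((norm p)\<^sup>2)"
    unfolding p_def norm_sum_e[OF assms] by simp
  finally have "inner p x = (norm p)\<^sup>2"
    by (simp add: inner_eq_Re_cinner)
  then have "(norm p)\<^sup>2 \<le> norm p * norm x"
    using norm_cauchy_schwarz[of p x] by simp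
  then have "norm p \<le> norm x"
    by (cases "p = 0") (auto simp: power2_eq_square)
  then show ?thesis
    using norm_sum_e[OF assms, of "\<lambda>l. cinner x (e l)"] power_mono[of "norm p" "norm x" 2]
    by (simp add: p_def)
qed

text \<open>By \<open>norm_sum_e\<close> a tail of the vector series has as squared norm the
  corresponding tail of \<open>c\<close>, which converges by Bessel. The partial sums are thus
  Cauchy along the finite subsets of \<open>S\<close>.\<close>

lemma summable_e: "(\<lambda>l. cinner x (e l) *\<^sub>C e l) summable_on S"
proof -
  define f c where "f = (\<lambda>l. cinner x (e l) *\<^sub>C e l)" and "c = (\<lambda>l. (cmod (cinner x (e l)))\<^sup>2)"
  have "c summable_on S"
    by (rule nonneg_bdd_above_summable_on)
      (auto simp: c_def intro!: bdd_aboveI2[where M="(norm x)\<^sup>2"] Bessel)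
  then obtain L where L: "(sum c \<longlongrightarrow> L) (finite_subsets_at_top S)"
    by (auto simp: summable_on_def has_sum_def)
  have tail: "\<exists>F0. finite F0 \<and> F0 \<subseteq> S \<and> (\<forall>F. finite F \<and> F0 \<subseteq> F \<and> F \<subseteq> S \<longrightarrow> norm (sum f F - sum f F0) < d)"
    if "d > 0" for d
  proof -
    have "\<forall>\<^sub>F F in finite_subsets_at_top S. dist (sum c F) L < d\<^sup>2 / 2"
      using L that by (intro tendstoD) auto
    then obtain F0 where F0: "finite F0" "F0 \<subseteq> S"
      "\<And>F. finite F \<Longrightarrow> F0 \<subseteq> F \<Longrightarrow> F \<subseteq> S \<Longrightarrow> dist (sum c F) L < d\<^sup>2 / 2"
      by (auto simp: eventually_finite_subsets_at_top)
    have "norm (sum f F - sum f F0) < d" if F: "finite F" "F0 \<subseteq> F" "F \<subseteq> S" for F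
    proof -
      have "(norm (sum f F - sum f F0))\<^sup>2 = (norm (sum f (F - F0)))\<^sup>2"
        using F by (simp add: sum_diff)
      also have "\<dots> = sum c (F - F0)"
        unfolding f_def c_def using F by (intro norm_sum_e) auto
      also have "\<dots> = sum c F - sum c F0"
        using F by (simp add: sum_diff)
      also have "\<dots> < d\<^sup>2"
        using F0(3)[OF F] F0(3)[OF F0(1) order_refl F0(2)] unfolding dist_real_def by linarith
      finally show ?thesis
        using that \<open>d > 0\<close> by (simp add: power_less_imp_less_base)
    qed
    then show ?thesis
      using F0 by blast
  qed
  have "cauchy_filter (filtermap (sum f) (finite_subsets_at_top S))"
    unfolding cauchy_filter_metric_filtermap
  proof (intro allI impI)
    fix d :: real assume "d > 0"
    then obtain F0 where F0: "finite F0" "F0 \<subseteq> S"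
      "\<And>F. finite F \<Longrightarrow> F0 \<subseteq> F \<Longrightarrow> F \<subseteq> S \<Longrightarrow> norm (sum f F - sum f F0) < d / 2"
      using tail[of "d / 2"] by auto
    show "\<exists>P. eventually P (finite_subsets_at_top S) \<and> (\<forall>F F'. P F \<and> P F' \<longrightarrow> dist (sum f F) (sum f F') < d)"
    proof (intro exI conjI allI impI)
      show "\<forall>\<^sub>F F in finite_subsets_at_top S. finite F \<and> F0 \<subseteq> F \<and> F \<subseteq> S"
        using F0 by (auto simp: eventually_finite_subsets_at_top)
      fix F F' assume "(finite F \<and> F0 \<subseteq> F \<and> F \<subseteq> S) \<and> (finite F' \<and> F0 \<subseteq> F' \<and> F' \<subseteq> S)"
      then show "dist (sum f F) (sum f F') < d"
        using F0(3)[of F] F0(3)[of F'] dist_triangle_half_l[of "sum f F" "sum f F0" d "sum f F'"]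
        by (simp add: dist_norm norm_minus_commute)
    qed
  qed
  moreover have "complete (UNIV :: 'a set)"
    by (meson Cauchy_convergent UNIV_I complete_def convergent_def)
  ultimately obtain s where "(sum f \<longlongrightarrow> s) (finite_subsets_at_top S)"
    using complete_uniform[where S=UNIV] by (force simp: filterlim_def)
  then show ?thesis
    by (auto simp: f_def summable_on_def has_sum_def)
qed

text \<open>The sum \<open>s\<close> has the same coefficients as \<open>x\<close>, and eigenspaces
  are lines, so \<open>x - s\<close> is orthogonal to every eigenvector and completeness
  applies.\<close>

lemma has_sum_e: "((\<lambda>l. cinner x (e l) *\<^sub>C e l) has_sum x) S"
proof -
  obtain s where s: "((\<lambda>l. cinner x (e l) *\<^sub>C e l) has_sum s) S"
    using summable_e by (auto simp: summable_on_def)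
  have coeff: "cinner s (e k) = cinner x (e k)" if k: "k \<in> S" for k
  proof -
    have "((\<lambda>l. cinner (cinner x (e l) *\<^sub>C e l) (e k)) has_sum cinner s (e k)) S"
      using has_sum_bounded_linear[OF bounded_linear_cinner_left s] by simp
    moreover have "((\<lambda>l. cinner (cinner x (e l) *\<^sub>C e l) (e k)) has_sum cinner x (e k)) S"
    proof -
      have "((\<lambda>l. cinner (cinner x (e l) *\<^sub>C e l) (e k)) has_sum cinner x (e k)) {k}"
        using k by (intro has_sum_finiteI) (auto simp: cinner_scaleC_left cinner_e_e)
      then show ?thesis
        using k by (subst has_sum_cong_neutral[where T="{k}"]) (auto simp: cinner_scaleC_left cinner_e_e)
    qed
    ultimately show ?thesis
      by (rule has_sum_unique)
  qed
  have "cinner v (x - s) = 0" if v: "v \<in> D" "A v = l *\<^sub>C v" for v l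
  proof (cases "v = 0")
    case False
    then have l: "l \<in> S"
      using v by (intro eigenvalue_spectrum) (auto simp: eigenvalue_def)
    then obtain a where "v = a *\<^sub>C e l"
      using eigenvector_multiple[OF v] by blast
    then have "cinner (x - s) v = 0"
      using coeff[OF l] by (simp add: cinner_scaleC_right cinner_diff_left)
    then show ?thesis
      by (metis cinner_commute complex_cnj_zero)
  qed simp
  then have "x - s = 0"
    by (rule eigenvectors_complete)
  then show ?thesis
    using s by simp
qed

section \<open>Weights and the partial fraction series of the transfer function\<close>

definition w :: "complex \<Rightarrow> real"
  where "w l = (cmod (cinner b (e l)))\<^sup>2"

lemma cinner_coeff_e: "cinner (cinner b (e l) *\<^sub>C e l) b = of_real (w l)"
  unfolding w_def by (rule cinner_coeff)

lemma has_sum_w: "((\<lambda>l. complex_of_real (w l)) has_sum of_real ((norm b)\<^sup>2)) S"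
  using has_sum_bounded_linear[OF bounded_linear_cinner_left has_sum_e, of b b]
  by (simp add: cinner_coeff_e cinner_self)

lemma resolvent_e:
  assumes "z \<notin> S" "l \<in> S"
  shows "R z (e l) = (1 / (z - l)) *\<^sub>C e l"
proof -
  have "z - l \<noteq> 0"
    using assms by auto
  then have "z *\<^sub>C ((1 / (z - l)) *\<^sub>C e l) - A ((1 / (z - l)) *\<^sub>C e l) = e l"
    using e_mem[OF assms(2)] A_e[OF assms(2)]
    by (simp add: A_scaleC scaleC_scaleC flip: scaleC_diff_left diff_divide_distrib)
  then show ?thesis
    using resolvent_left[OF assms(1) scaleC_closed[OF e_mem[OF assms(2)]]] by metis
qed

text \<open>Apply the bounded functional \<open>cinner (R z x) b\<close> of \<open>x\<close> to the
  expansion of \<open>b\<close>; each \<open>e l\<close> is an eigenvector of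
  \<open>R z\<close>.\<close>

lemma has_sum_transfer_function:
  assumes "z \<notin> S"
  shows "((\<lambda>l. of_real (w l) / (z - l)) has_sum cinner (R z b) b) S"
proof -
  have "((\<lambda>l. cinner (R z (cinner b (e l) *\<^sub>C e l)) b) has_sum cinner (R z b) b) S"
    using has_sum_bounded_linear[OF bounded_linear_compose[OF bounded_linear_cinner_left
          bounded_linear_resolvent[OF assms]] has_sum_e] by (simp add: o_def)
  moreover have "cinner (R z (cinner b (e l) *\<^sub>C e l)) b = of_real (w l) / (z - l)" if "l \<in> S" for l
    using cinner_coeff_e[of l]
    by (simp add: resolvent_scaleC[OF assms] resolvent_e[OF assms that] cinner_scaleC_left)
  ultimately show ?thesis
    by (subst has_sum_cong) (auto cong: has_sum_cong)
qed

lemma cinner_resolvent_e: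
  assumes "l \<in> S" "s > 0"
  shows "cinner (R (of_real s) x) (e l) = cinner x (e l) / (of_real s - l)"
proof -
  have s: "complex_of_real s \<notin> S" "- cnj (complex_of_real s) \<notin> S"
    using Re_spectrum[of "of_real s"] Re_spectrum[of "- of_real s"] assms(2) by auto
  have "cinner (R (of_real s) x) (e l) = - (cnj (1 / (- of_real s - l)) * cinner x (e l))"
    using cinner_resolvent_left[OF s, of x "e l"] resolvent_e[OF s(2) assms(1)]
    by (simp add: cinner_scaleC_right)
  also have "cnj (1 / (- of_real s - l)) = - (1 / (of_real s - l))"
    using cnj_spectrum[OF assms(1)] by simp (metis minus_diff_eq minus_divide_right)
  finally show ?thesis
    by simp
qed

section \<open>The domain of the square root in terms of coefficients\<close>

text \<open>
  In the direction of an eigenvector with eigenvalue \<open>l\<close> the operator $(-A)^{1/2}$ is multiplication by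
  $c = \frac{1}{\pi}\int_0^\infty s^{-1/2}\frac{-l}{s - l}\,ds$. The real part of the integrand is positive
  and at least $\frac12 s^{-1/2}$ for $s \le |l|$, so $|c| \ge \sqrt{|l|}/\pi$.
\<close>

lemma balakrishnan_graph_coeff:
  assumes xy: "(x, y) \<in> balakrishnan_graph (1/2) D (\<lambda>x. - A x)" and l: "l \<in> S"
  shows "sqrt (cmod l) * cmod (cinner x (e l)) \<le> pi * cmod (cinner y (e l))"
proof (cases "cinner x (e l) = 0")
  case False
  define q where "q = Im l"
  have lq: "l = \<i> * of_real q"
    using Re_spectrum[OF l] by (simp add: q_def complex_eq_iff)
  define k where "k = (\<lambda>s. (s powr (- 1/2) / pi) *\<^sub>R (- l / (of_real s - l)))"
  define c where "c = cinner y (e l) / cinner x (e l)"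
  have x: "x \<in> D" and int: "((\<lambda>s. (1 / pi * s powr (- 1/2)) *\<^sub>R R (of_real s) (- A x)) has_integral y) {0<..}"
    using xy by (auto simp: balakrishnan_graph_def)
  have "cinner (- A x) (e l) = - l * cinner x (e l)"
    using skew[OF x e_mem[OF l]]
    by (simp add: cinner_minus_left A_e[OF l] cinner_scaleC_right cnj_spectrum[OF l])
  then have "cinner (R (of_real s) (- A x)) (e l) / cinner x (e l) = - l / (of_real s - l)" if "s > 0" for s
    using False cinner_resolvent_e[OF l that, of "- A x"] by simp
  then have eq: "cinner ((1 / pi * s powr (- 1/2)) *\<^sub>R R (of_real s) (- A x)) (e l) / cinner x (e l) = k s"
    if "s \<in> {0<..}" for s
    using that by (simp only: k_def cinner_scaleR_left scaleR_conv_of_real mult.commute[of "1 / pi"]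
        times_divide_eq_right[symmetric] greaterThan_iff) simp
  have "((\<lambda>s. cinner ((1 / pi * s powr (- 1/2)) *\<^sub>R R (of_real s) (- A x)) (e l))
      has_integral cinner y (e l)) {0<..}"
    using has_integral_linear[OF int bounded_linear_cinner_left[of "e l"]] by (simp only: o_def)
  then have "((\<lambda>s. cinner ((1 / pi * s powr (- 1/2)) *\<^sub>R R (of_real s) (- A x)) (e l) / cinner x (e l))
      has_integral c) {0<..}"
    unfolding c_def by (rule has_integral_divide)
  with eq have "(k has_integral c) {0<..}"
    by (rule has_integral_eq)
  from has_integral_linear[OF this bounded_linear_Re]
  have "((\<lambda>s. Re (k s)) has_integral Re c) {0<..}"
    by (simp only: o_def)
  then have k: "((\<lambda>s. if s \<in> {0<..} then Re (k s) else 0) has_integral Re c) UNIV"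
    by (subst has_integral_restrict) auto
  have "((\<lambda>s. s powr (- 1/2) * (1 / (2 * pi))) has_integral
      (\<bar>q\<bar> powr (- 1/2 + 1) / (- 1/2 + 1)) * (1 / (2 * pi))) {0..\<bar>q\<bar>}"
    by (intro has_integral_mult_left has_integral_powr_from_0) auto
  moreover have "(\<bar>q\<bar> powr (- 1/2 + 1) / (- 1/2 + 1)) * (1 / (2 * pi)) = sqrt \<bar>q\<bar> / pi"
    by (simp add: powr_half_sqrt)
  ultimately have "((\<lambda>s. s powr (- 1/2) * (1 / (2 * pi))) has_integral sqrt \<bar>q\<bar> / pi) {0..\<bar>q\<bar>}"
    by simp
  then have g: "((\<lambda>s. if s \<in> {0..\<bar>q\<bar>} then s powr (- 1/2) * (1 / (2 * pi)) else 0)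
      has_integral sqrt \<bar>q\<bar> / pi) UNIV"
    by (subst has_integral_restrict) auto
  have "sqrt \<bar>q\<bar> / pi \<le> Re c"
  proof (rule has_integral_le[OF g k])
    fix s :: real
    have Re_k: "Re (k s) = s powr (- 1/2) / pi * (q\<^sup>2 / (s\<^sup>2 + q\<^sup>2))"
      by (simp add: k_def lq Re_divide cmod_power2 power2_eq_square)
    have "1 / 2 \<le> q\<^sup>2 / (s\<^sup>2 + q\<^sup>2)" if "0 < s" "s \<le> \<bar>q\<bar>"
    proof -
      have "s\<^sup>2 \<le> q\<^sup>2"
        using that by (simp add: abs_le_square_iff[symmetric])
      moreover have "s\<^sup>2 + q\<^sup>2 > 0"
        using that by (intro add_pos_nonneg) auto
      ultimately show ?thesis
        by (simp add: field_simps)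
    qed
    then have "s powr (- 1/2) / pi * (1 / 2) \<le> Re (k s)" if "0 < s" "s \<le> \<bar>q\<bar>"
      unfolding Re_k using that by (intro mult_left_mono) auto
    moreover have "0 \<le> Re (k s)"
      unfolding Re_k by auto
    \<comment> \<open>At \<open>s = 0\<close> the left side is also 0, because
      \<open>0 powr a = 0\<close>.\<close>
    ultimately show "(if s \<in> {0..\<bar>q\<bar>} then s powr (- 1/2) * (1 / (2 * pi)) else 0)
        \<le> (if s \<in> {0<..} then Re (k s) else 0)"
      by (cases "s = 0") auto
  qed
  then have "sqrt (cmod l) / pi \<le> cmod c"
    using complex_Re_le_cmod[of c] by (simp add: lq norm_mult)
  then show ?thesis
    using False by (simp add: c_def norm_divide field_simps)
qed simp

text \<open>The estimate describes a closed set of pairs, so it survives the closure in the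
  definition of the fractional power.\<close>

lemma frac_power_graph_coeff:
  assumes "(x, y) \<in> frac_power_graph (1/2) D (\<lambda>x. - A x)" and l: "l \<in> S"
  shows "sqrt (cmod l) * cmod (cinner x (e l)) \<le> pi * cmod (cinner y (e l))"
proof -
  define Z where "Z = {p. sqrt (cmod l) * cmod (cinner (fst p) (e l)) \<le> pi * cmod (cinner (snd p) (e l))}"
  have "closed Z"
    unfolding Z_def
    by (intro closed_Collect_le continuous_intros
        bounded_linear.continuous_on[OF bounded_linear_cinner_left])
  moreover have "balakrishnan_graph (1/2) D (\<lambda>x. - A x) \<subseteq> Z"
    using balakrishnan_graph_coeff[OF _ l] by (auto simp: Z_def)
  ultimately have "frac_power_graph (1/2) D (\<lambda>x. - A x) \<subseteq> Z"
    unfolding frac_power_graph_def by (rule closure_minimal[rotated])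
  then show ?thesis
    using assms(1) by (auto simp: Z_def)
qed

text \<open>Square the coefficient estimate and apply Bessel to \<open>y\<close>. Only summability
  is wanted, so the crude factor \<open>pi\<close> is harmless.\<close>

lemma summable_weights:
  assumes "b \<in> frac_power_domain (1/2) D (\<lambda>x. - A x)"
  shows "(\<lambda>l. cmod l * w l) summable_on S"
proof -
  obtain y where y: "(b, y) \<in> frac_power_graph (1/2) D (\<lambda>x. - A x)"
    using assms by (auto simp: frac_power_domain_def)
  have le: "cmod l * w l \<le> pi\<^sup>2 * (cmod (cinner y (e l)))\<^sup>2" if "l \<in> S" for l
    using power_mono[OF frac_power_graph_coeff[OF y that], of 2]
    by (simp add: w_def power_mult_distrib)
  have "(\<Sum>l\<in>F. cmod l * w l) \<le> pi\<^sup>2 * (norm y)\<^sup>2" if "finite F" "F \<subseteq> S" for F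
  proof -
    have "(\<Sum>l\<in>F. cmod l * w l) \<le> (\<Sum>l\<in>F. pi\<^sup>2 * (cmod (cinner y (e l)))\<^sup>2)"
      using that le by (intro sum_mono) auto
    also have "\<dots> \<le> pi\<^sup>2 * (norm y)\<^sup>2"
      unfolding sum_distrib_left[symmetric] by (intro mult_left_mono Bessel that) auto
    finally show ?thesis .
  qed
  then show ?thesis
    by (intro nonneg_bdd_above_summable_on)
      (auto simp: w_def intro!: bdd_aboveI2[where M="pi\<^sup>2 * (norm y)\<^sup>2"])
qed

section \<open>Zeros of the transfer function\<close>

text \<open>
  At a zero \<open>z\<close> one has $0 = \sum_l \frac{z w_l}{z - l} = \|b\|^2 + \sum_l \frac{l w_l}{z - l}$. Far from the
  spectrum the last sum is dominated by the summable $|l| w_l$, so it tends to 0 as $|z| \to \infty$.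
\<close>

lemma bounded_far_zeros:
  assumes summ: "(\<lambda>l. cmod l * w l) summable_on S" and "\<epsilon> > 0" "b \<noteq> 0"
  shows "bounded {z. z \<notin> S \<and> (\<forall>l\<in>S. \<epsilon> \<le> cmod (z - l)) \<and> cinner (R z b) b = 0}"
proof -
  define W where "W = (norm b)\<^sup>2"
  have "W > 0"
    using \<open>b \<noteq> 0\<close> by (simp add: W_def)
  define h where "h = (\<lambda>l. cmod l * w l)"
  have h_nonneg: "h l \<ge> 0" for l
    by (simp add: h_def w_def)
  obtain H where H: "(h has_sum H) S"
    using summ by (auto simp: h_def summable_on_def)
  \<comment> \<open>Budget for a sum that must reach \<open>W\<close> in modulus: outside
    \<open>F\<close> the terms give at most \<open>W / 4\<close>, since \<open>F\<close> misses at
    most \<open>\<epsilon> * W / 4\<close> of \<open>H\<close> and distances are at least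
    \<open>\<epsilon>\<close>; inside \<open>F\<close> they give less than \<open>W / 2\<close> once
    \<open>cmod z\<close> exceeds \<open>M + 2 * h0 / W\<close>.\<close>
  obtain F where F: "finite F" "F \<subseteq> S" "dist (sum h F) H \<le> \<epsilon> * W / 4"
    using has_sum_finite_approximation[OF H, of "\<epsilon> * W / 4"] \<open>W > 0\<close> \<open>\<epsilon> > 0\<close> by auto
  define h0 where "h0 = sum h F"
  \<comment> \<open>Dominates \<open>cmod l\<close> for all \<open>l\<close> in \<open>F\<close>;
    unlike a maximum, a sum needs no case split for empty \<open>F\<close>.\<close>
  define M where "M = (\<Sum>l\<in>F. cmod l)"
  have h0: "h0 \<ge> 0"
    by (simp add: h0_def sum_nonneg h_nonneg)
  have "cmod z \<le> M + 2 * h0 / W"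
    if z: "z \<notin> S" "\<And>l. l \<in> S \<Longrightarrow> \<epsilon> \<le> cmod (z - l)" "cinner (R z b) b = 0" for z
  proof (rule ccontr)
    assume unbounded: "\<not> cmod z \<le> M + 2 * h0 / W"
    define d where "d = cmod z - M"
    have d: "d > 2 * h0 / W"
      using unbounded by (simp add: d_def)
    moreover have "2 * h0 / W \<ge> 0"
      using h0 \<open>W > 0\<close> by simp
    ultimately have "d > 0"
      by linarith
    have "((\<lambda>l. z * (of_real (w l) / (z - l))) has_sum z * 0) S"
      using has_sum_bounded_linear[OF bounded_linear_mult_right has_sum_transfer_function[OF z(1)], of z]
      by (simp add: z(3))
    from has_sum_diff[OF this has_sum_w]
    have "((\<lambda>l. z * (of_real (w l) / (z - l)) - of_real (w l)) has_sum of_real (- W)) S"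
      by (simp add: W_def)
    moreover have "z * (of_real (w l) / (z - l)) - of_real (w l) = l * of_real (w l) / (z - l)"
      if "l \<in> S" for l
    proof -
      have "z - l \<noteq> 0"
        using that z(1) by auto
      then show ?thesis
        by (simp add: field_simps)
    qed
    ultimately have "((\<lambda>l. l * of_real (w l) / (z - l)) has_sum of_real (- W)) S"
      by (simp cong: has_sum_cong)
    from has_sum_bounded_linear[OF bounded_linear_Re this]
    have sum1: "((\<lambda>l. Re (l * of_real (w l) / (z - l))) has_sum - W) S"
      by simp
    define g where "g = (\<lambda>l. if l \<in> F then h l * (1 / d) else h l * (1 / \<epsilon>))"
    have "(g has_sum h0 * (1 / d)) F"
      using F(1) by (intro has_sum_finiteI) (auto simp: g_def h0_def sum_divide_distrib)
    moreover have "(h has_sum (H - h0)) (S - F)"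
      unfolding h0_def using F by (intro has_sum_Diff H has_sum_finite)
    then have "((\<lambda>l. h l * (1 / \<epsilon>)) has_sum (H - h0) * (1 / \<epsilon>)) (S - F)"
      by (rule has_sum_bounded_linear[OF bounded_linear_mult_left])
    then have "(g has_sum (H - h0) * (1 / \<epsilon>)) (S - F)"
      by (subst has_sum_cong[where g="\<lambda>l. h l * (1 / \<epsilon>)"]) (auto simp: g_def)
    ultimately have "(g has_sum (h0 * (1 / d) + (H - h0) * (1 / \<epsilon>))) (F \<union> (S - F))"
      by (rule has_sum_Un_disjoint) auto
    moreover have "F \<union> (S - F) = S"
      using F(2) by auto
    ultimately have "((\<lambda>l. - g l) has_sum - (h0 * (1 / d) + (H - h0) * (1 / \<epsilon>))) S"
      by (simp add: has_sum_uminus add.commute)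
    then have "- (h0 * (1 / d) + (H - h0) * (1 / \<epsilon>)) \<le> - W"
    proof (rule has_sum_mono[OF _ sum1])
      fix l assume l: "l \<in> S"
      have "cmod (l * of_real (w l) / (z - l)) = h l * (1 / cmod (z - l))"
        by (simp add: h_def norm_mult norm_divide norm_power w_def)
      also have "\<dots> \<le> g l"
      proof (cases "l \<in> F")
        case True
        then have "cmod l \<le> M"
          unfolding M_def using F(1) by (intro member_le_sum) auto
        then have "d \<le> cmod (z - l)"
          using norm_triangle_ineq2[of z l] by (simp add: d_def)
        then show ?thesis
          using True \<open>d > 0\<close> h_nonneg[of l]
          by (auto simp: g_def intro!: mult_left_mono divide_left_mono mult_pos_pos)
      next
        case False
        then show ?thesis
          using z(2)[OF l] \<open>\<epsilon> > 0\<close> h_nonneg[of l]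
          by (auto simp: g_def intro!: mult_left_mono divide_left_mono mult_pos_pos)
      qed
      finally show "- g l \<le> Re (l * of_real (w l) / (z - l))"
        using abs_Re_le_cmod[of "l * of_real (w l) / (z - l)"] by linarith
    qed
    moreover have "h0 * (1 / d) < W / 2"
      using d \<open>d > 0\<close> \<open>W > 0\<close> by (simp add: field_simps)
    moreover have "(H - h0) * (1 / \<epsilon>) \<le> W / 4"
    proof -
      have "H - h0 \<le> \<epsilon> * W / 4"
        using F(3) unfolding h0_def dist_real_def by linarith
      then show ?thesis
        using \<open>\<epsilon> > 0\<close> by (simp add: field_simps)
    qed
    ultimately show False
      using \<open>W > 0\<close> by linarith
  qed
  then show ?thesis
    by (intro boundedI) blast
qed

text \<open>Strict monotonicity in difference form: on the imaginary axis the difference quotient of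
  the transfer function is the sum of \<open>w l / (Im (z1 - l) * Im (z2 - l))\<close>. Two distinct
  zeros make it vanish, although no term is negative and some term is positive.\<close>

lemma far_zeros_separated:
  assumes "b \<noteq> 0"
    and z1: "z1 \<notin> S" "\<And>l. l \<in> S \<Longrightarrow> \<epsilon> \<le> cmod (z1 - l)" "cinner (R z1 b) b = 0" "Re z1 = 0"
    and z2: "z2 \<notin> S" "cinner (R z2 b) b = 0" "Re z2 = 0"
    and near: "cmod (z1 - z2) < \<epsilon>"
  shows "z1 = z2"
proof (rule ccontr)
  assume "z1 \<noteq> z2"
  have "((\<lambda>l. of_real (w l) / (z1 - l) - of_real (w l) / (z2 - l)) has_sum 0) S"
    using has_sum_diff[OF has_sum_transfer_function[OF z1(1)] has_sum_transfer_function[OF z2(1)]]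
    by (simp add: z1(3) z2(2))
  from has_sum_bounded_linear[OF bounded_linear_mult_right[of "1 / (z1 - z2)"] this]
  have "((\<lambda>l. (1 / (z1 - z2)) * (of_real (w l) / (z1 - l) - of_real (w l) / (z2 - l))) has_sum 0) S"
    by simp
  moreover have "(1 / (z1 - z2)) * (of_real (w l) / (z1 - l) - of_real (w l) / (z2 - l))
      = of_real (w l / (Im (z1 - l) * Im (z2 - l)))" if l: "l \<in> S" for l
  proof -
    have "z1 - l \<noteq> 0" "z2 - l \<noteq> 0" "z1 - z2 \<noteq> 0"
      using \<open>z1 \<noteq> z2\<close> l z1(1) z2(1) by auto
    then have "(1 / (z1 - z2)) * (of_real (w l) / (z1 - l) - of_real (w l) / (z2 - l))
        = - (of_real (w l) / ((z1 - l) * (z2 - l)))"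
      by (simp add: divide_simps) (simp add: algebra_simps)
    moreover have "(z1 - l) * (z2 - l) = - of_real (Im (z1 - l) * Im (z2 - l))"
      using Re_spectrum[OF l] z1(4) z2(3) by (simp add: complex_eq_iff)
    ultimately show ?thesis
      by simp
  qed
  ultimately have "((\<lambda>l. complex_of_real (w l / (Im (z1 - l) * Im (z2 - l)))) has_sum 0) S"
    by (simp cong: has_sum_cong)
  from has_sum_bounded_linear[OF bounded_linear_Re this]
  have sum0: "((\<lambda>l. w l / (Im (z1 - l) * Im (z2 - l))) has_sum 0) S"
    by simp
  text \<open>No point of the spectrum lies between \<open>z1\<close> and \<open>z2\<close>.\<close>
  have pos: "Im (z1 - l) * Im (z2 - l) > 0" if l: "l \<in> S" for l
  proof -
    have "cmod (z1 - l) = \<bar>Im (z1 - l)\<bar>" "cmod (z1 - z2) = \<bar>Im z1 - Im z2\<bar>"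
      using Re_spectrum[OF l] z1(4) z2(3) by (simp_all add: cmod_eq_Im)
    then have "\<bar>Im z1 - Im z2\<bar> < \<bar>Im z1 - Im l\<bar>"
      using z1(2)[OF l] near by simp
    then show ?thesis
      by (cases "Im z1 < Im l") (auto simp: zero_less_mult_iff)
  qed
  have "\<exists>l\<in>S. w l \<noteq> 0"
  proof (rule ccontr)
    assume "\<not> (\<exists>l\<in>S. w l \<noteq> 0)"
    then have "((\<lambda>l. complex_of_real (w l)) has_sum 0) S"
      by (intro has_sum_0) auto
    then have "complex_of_real ((norm b)\<^sup>2) = 0"
      using has_sum_w has_sum_unique by blast
    then show False
      using \<open>b \<noteq> 0\<close> by simp
  qed
  then obtain k where k: "k \<in> S" "w k > 0"
    unfolding w_def by force
  have "(0::real) < 0"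
  proof (rule has_sum_strict_mono[OF has_sum_0 sum0])
    show "0 < w k / (Im (z1 - k) * Im (z2 - k))"
      using k pos by simp
    show "0 \<le> w l / (Im (z1 - l) * Im (z2 - l))" if "l \<in> S" for l
      using pos[OF that] by (simp add: w_def)
  qed (use k in auto)
  then show False
    by simp
qed

text \<open>Separation by \<open>\<epsilon>\<close> makes the set closed and discrete, boundedness
  makes it compact, and a compact discrete set is finite.\<close>

lemma finite_far_zeros:
  assumes "b \<in> frac_power_domain (1/2) D (\<lambda>x. - A x)" "\<epsilon> > 0" "b \<noteq> 0"
  shows "finite {z. z \<notin> S \<and> Re z = 0 \<and> (\<forall>l\<in>S. \<epsilon> \<le> cmod (z - l)) \<and> cinner (R z b) b = 0}"
    (is "finite ?Z")
proof -
  have "uniform_discrete ?Z"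
    unfolding uniform_discrete_def dist_norm
  proof (intro exI[of _ \<epsilon>] conjI ballI impI)
    fix z1 z2 assume "z1 \<in> ?Z" "z2 \<in> ?Z" "cmod (z1 - z2) < \<epsilon>"
    then show "z1 = z2"
      by (intro far_zeros_separated[OF \<open>b \<noteq> 0\<close>, of z1 \<epsilon> z2]) simp_all
  qed (fact \<open>\<epsilon> > 0\<close>)
  moreover have "bounded ?Z"
    by (rule bounded_subset[OF bounded_far_zeros[OF summable_weights[OF assms(1)] assms(2,3)]]) auto
  ultimately have "compact ?Z" "discrete ?Z"
    by (auto simp: compact_eq_bounded_closed uniform_discrete_imp_closed uniform_discrete_imp_discrete)
  then have "finite (?Z \<inter> ?Z)"
    by (intro finite_not_islimpt_in_compact) (auto simp: discrete_def isolated_in_islimpt_iff)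
  then show ?thesis
    by simp
qed

end

text \<open>The index set \<open>I\<close> admits a finite set of zeros, where a large
  \<open>N\<close> leaves nothing to show. In general, injectivity of \<open>\<mu>\<close> turns
  finitely many exceptional zeros into finitely many exceptional indices.\<close>

theorem theorem6p6:
  fixes D :: "'z::complex_hilbert_space set"
    and A :: "'z \<Rightarrow> 'z" and B :: "complex \<Rightarrow> 'z" and C :: "'z \<Rightarrow> complex"
    and b :: 'z and I :: "nat set" and \<mu> :: "nat \<Rightarrow> complex" and \<epsilon> :: real
  assumes "siso_system D A B C"
    and "\<And>u. B u = u *\<^sub>C b"
    and "collocated_skew_adjoint D A B C"
    and "minimal_system D A B C"
    and "b \<in> frac_power_domain (1/2) D (\<lambda>x. - A x)"
    and "bij_betw \<mu> I (invariant_zeros D A B C)"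
    and "\<epsilon> > 0"
  shows "\<exists>N. \<forall>n\<in>I. n \<ge> N \<longrightarrow> (\<exists>l. eigenvalue D A l \<and> cmod (\<mu> n - l) < \<epsilon>)"
proof -
  interpret skew_adjoint_discrete D A
    using assms(1,3) by unfold_locales (auto simp: siso_system_def collocated_skew_adjoint_def)
  have C: "C x = cinner x b" for x
  proof -
    have "(x, C x) \<in> adjoint_graph UNIV B"
      using assms(3) by (auto simp: collocated_skew_adjoint_def op_graph_def)
    then have "cinner (B 1) x = cinner 1 (C x)"
      by (simp add: adjoint_graph_def)
    then have "cinner b x = cnj (C x)"
      by (simp add: assms(2) cinner_complex_def)
    then show ?thesis
      by (metis cinner_commute complex_cnj_cnj)
  qed
  have "b \<noteq> 0"
    using assms(1,2) by (auto simp: siso_system_def fun_eq_iff)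
  have minimal: "z \<notin> S" if "z \<in> invariant_zeros D A B C" for z
    using assms(4) that by (auto simp: minimal_system_def)
  interpret skew_adjoint_observable D A b
  proof
    fix x l assume x: "x \<in> D" "A x = l *\<^sub>C x" "cinner x b = 0"
    show "x = 0"
    proof (rule ccontr)
      assume "x \<noteq> 0"
      then have "l \<in> invariant_zeros D A B C"
        using x by (auto simp: invariant_zeros_def C assms(2) intro!: bexI[of _ x] exI[of _ 0])
      moreover have "l \<in> S"
        using x \<open>x \<noteq> 0\<close> by (intro eigenvalue_spectrum) (auto simp: eigenvalue_def)
      ultimately show False
        using minimal by blast
    qed
  qed
  define Z where "Z = {z. z \<notin> S \<and> Re z = 0 \<and> (\<forall>l\<in>S. \<epsilon> \<le> cmod (z - l)) \<and> cinner (R z b) b = 0}"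
  \<comment> \<open>Pairing the zero equation with \<open>x\<close> removes the input, as
    \<open>x\<close> is orthogonal to \<open>b\<close>, and leaves \<open>z\<close> times a positive
    number equal to the imaginary \<open>cinner (A x) x\<close>. Solving it gives
    \<open>x = u *\<^sub>C R z b\<close> with \<open>u\<close> nonzero, so
    \<open>cinner x b = 0\<close> passes to \<open>R z b\<close>.\<close>
  have zero: "Re z = 0 \<and> cinner (R z b) b = 0" if z: "z \<in> invariant_zeros D A B C" for z
  proof -
    obtain x u where x: "x \<in> D" "x \<noteq> 0" "z *\<^sub>C x - A x = u *\<^sub>C b" "cinner x b = 0"
      using z by (auto simp: invariant_zeros_def C assms(2))
    have bx: "cinner b x = 0"
      using x(4) by (metis cinner_commute complex_cnj_zero)
    have "cinner (z *\<^sub>C x - A x) x = 0"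
      unfolding x(3) by (simp add: cinner_scaleC_left bx)
    then have "z * of_real ((norm x)\<^sup>2) = cinner (A x) x"
      by (simp only: cinner_diff_left cinner_scaleC_left cinner_self right_minus_eq)
    then have "Re z * (norm x)\<^sup>2 = 0"
      using Re_cinner_A[OF x(1)] by (metis Re_complex_of_real Im_complex_of_real diff_zero mult_zero_right times_complex.sel(1))
    moreover have "x = u *\<^sub>C R z b"
      using resolvent_left[OF minimal[OF z] x(1)] resolvent_scaleC[OF minimal[OF z]] by (simp add: x(3))
    then have "u * cinner (R z b) b = 0" "u \<noteq> 0"
      using x(2,4) by (auto simp: cinner_scaleC_left)
    ultimately show ?thesis
      using x(2) by simp
  qed
  have "finite Z"
    unfolding Z_def by (rule finite_far_zeros[OF assms(5,7) \<open>b \<noteq> 0\<close>])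
  moreover have "\<mu> ` {n\<in>I. \<mu> n \<in> Z} \<subseteq> Z" "inj_on \<mu> {n\<in>I. \<mu> n \<in> Z}"
    using bij_betw_imp_inj_on[OF assms(6)] by (auto intro: inj_on_subset)
  ultimately have "finite {n\<in>I. \<mu> n \<in> Z}"
    by (meson finite_imageD finite_subset)
  then obtain N where N: "\<And>n. n \<in> I \<Longrightarrow> \<mu> n \<in> Z \<Longrightarrow> n < N"
    by (auto simp: finite_nat_set_iff_bounded)
  have "\<exists>l. eigenvalue D A l \<and> cmod (\<mu> n - l) < \<epsilon>" if n: "n \<in> I" "n \<ge> N" for n
  proof -
    have "\<mu> n \<in> invariant_zeros D A B C"
      using bij_betwE[OF assms(6)] n(1) by blast
    moreover have "\<mu> n \<notin> Z"
      using N[OF n(1)] n(2) by auto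
    \<comment> \<open>\<open>\<mu> n\<close> satisfies all other clauses of \<open>Z\<close>, so it
      is the distance clause that fails.\<close>
    ultimately obtain l where "l \<in> S" "cmod (\<mu> n - l) < \<epsilon>"
      using zero minimal by (force simp: Z_def not_le)
    then show ?thesis
      using spectrum_eigenvalue by blast
  qed
  then show ?thesis
    by blast
qed

end
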